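(* Let $r>0$ be arbitrary, let $\alpha>1$ and let $0<\bar c<\bar c^{\ast}$. Then the support of the capacity-achieving input distribution $p_X^{\ast}$ is the entire interval $[0,1]$.
   Context: Fix $b>0$ and set $r:=1/(2b)$, $n:=\lfloor r\rfloor$. Consider the additive uniform noise channel $Y=X+N$ with $N\sim\mathrm{Uniform}(-b,b)$ independent of $X$, so the transition density is $p_N(y\mid x)=r\,\mathbf{1}_{x-b<y<x+b}$. Admissible inputs are probability distributions $p_X$ on $[0,1]$ (peak amplitude constraint). For such $p_X$ the output density is $p_Y(y;p_X)=\int p_N(y\mid x)\,dp_X(x)$, the marginal information density is $i(x;p_X)=\int p_N(y\mid x)\log\frac{p_N(y\mid x)}{p_Y(y;p_X)}\,dy\in[0,\infty]$, and $I(p_X)=\int i(x;p_X)\,dp_X(x)$ is the mutual information between $X$ and $Y$. The cost function is $c(x)=x^{\alpha}$ with $\alpha>0$. For $\bar c>0$, the capacity-achieving input distribution $p_X^{\ast}$ is the (unique) maximizer of $I(p_X)$ over probability distributions $p_X$ on $[0,1]$ with $\mathbb{E}_{p_X}[c(X)]\le \bar c$. Standard points and masses: let $N_r=n+1$ if $r\in\mathbb{N}$ and $N_r=2n+2$ if $r\notin\mathbb{N}$. For $j=1,\dots,N_r$ set $x_j=(j-1)/n$ if $r\in\mathbb{N}$; if $r\notin\mathbb{N}$, set $x_j=(j-1)/(2r)$ for odd $j$ and $x_j=1-(2n+2-j)/(2r)$ for even $j$. Define the unconstrained masses $m^0_j=1/(n+1)$ if $r\in\mathbb{N}$; if $r\notin\mathbb{N}$,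 $m^0_j=\frac{2n+2-(j-1)}{2(n+1)(n+2)}$ for odd $j$ and $m^0_j=\frac{j}{2(n+1)(n+2)}$ for even $j$. The distribution $\sum_j m^0_j\delta_{x_j}$ is the capacity-achieving input distribution without cost constraint, and the critical cost is $\bar c^{\ast}:=\sum_{j=1}^{N_r} m^0_j\,x_j^{\alpha}$ (the cost constraint is active iff $\bar c<\bar c^\ast$). *)

theory Defs
  imports "HOL-Probability.Probability"
begin

section \<open>Additive uniform noise channel Y = X + N, N ~ Uniform(-b,b), r = 1/(2b)\<close>

definition rpar :: "real \<Rightarrow> real" where
  "rpar b = 1 / (2 * b)"

definition npar :: "real \<Rightarrow> nat" where
  "npar b = nat \<lfloor>rpar b\<rfloor>"

definition trans_dens :: "real \<Rightarrow> real \<Rightarrow> real \<Rightarrow> real" where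
  "trans_dens b x y = rpar b * indicator {x - b<..<x + b} y"

definition admissible :: "real measure \<Rightarrow> bool" where
  "admissible p \<longleftrightarrow> prob_space p \<and> sets p = sets borel \<and> emeasure p {0..1} = 1"

definition out_dens :: "real \<Rightarrow> real measure \<Rightarrow> real \<Rightarrow> real" where
  "out_dens b p y = (\<integral>x. trans_dens b x y \<partial>p)"

definition info_dens :: "real \<Rightarrow> real measure \<Rightarrow> real \<Rightarrow> ennreal" where
  "info_dens b p x = (\<integral>\<^sup>+ y.
     (if trans_dens b x y = 0 then 0
      else if out_dens b p y = 0 then \<infinity>
      else ennreal (trans_dens b x y * ln (trans_dens b x y / out_dens b p y))) \<partial>lborel)"

definition mutual_info :: "real \<Rightarrow> real measure \<Rightarrow> ennreal" where
  "mutual_info b p = (\<integral>\<^sup>+ x. info_dens b p x \<partial>p)"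

definition cost :: "real \<Rightarrow> real \<Rightarrow> real" where
  "cost \<alpha> x = x powr \<alpha>"

definition feasible :: "real \<Rightarrow> real \<Rightarrow> real measure \<Rightarrow> bool" where
  "feasible \<alpha> cbar p \<longleftrightarrow> admissible p \<and> (\<integral>x. cost \<alpha> x \<partial>p) \<le> cbar"

definition capacity_achieving :: "real \<Rightarrow> real \<Rightarrow> real \<Rightarrow> real measure \<Rightarrow> bool" where
  "capacity_achieving b \<alpha> cbar p \<longleftrightarrow>
     feasible \<alpha> cbar p \<and> (\<forall>q. feasible \<alpha> cbar q \<longrightarrow> mutual_info b q \<le> mutual_info b p)"

definition Nr :: "real \<Rightarrow> nat" where
  "Nr b = (if rpar b \<in> \<nat> then npar b + 1 else 2 * npar b + 2)"

definition std_point :: "real \<Rightarrow> nat \<Rightarrow> real" where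
  "std_point b j =
     (if rpar b \<in> \<nat> then (real j - 1) / real (npar b)
      else if odd j then (real j - 1) / (2 * rpar b)
      else 1 - (real (2 * npar b + 2) - real j) / (2 * rpar b))"

definition std_mass :: "real \<Rightarrow> nat \<Rightarrow> real" where
  "std_mass b j =
     (if rpar b \<in> \<nat> then 1 / real (npar b + 1)
      else if odd j then (real (2 * npar b + 2) - (real j - 1))
                          / (2 * real (npar b + 1) * real (npar b + 2))
      else real j / (2 * real (npar b + 1) * real (npar b + 2)))"

definition crit_cost :: "real \<Rightarrow> real \<Rightarrow> real" where
  "crit_cost b \<alpha> = (\<Sum>j = 1..Nr b. std_mass b j * (std_point b j) powr \<alpha>)"

definition support :: "real measure \<Rightarrow> real set" where
  "support p = {x. \<forall>U. open U \<longrightarrow> x \<in> U \<longrightarrow> emeasure p U > 0}"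

end

theory Submission
  imports Defs
begin

text \<open>
  Let \<open>F(y)\<close> be the probability that \<open>X\<close> lies in the window \<open>(y - b, y + b)\<close>. Then
  \<open>I = r \<integral> -F ln F\<close> is concave in the input, and first-order optimality (two-point comparison inputs)
  gives a multiplier \<open>\<mu> \<ge> 0\<close> with \<open>i(x) - I \<le> \<mu> (c(x) - cbar)\<close> on \<open>[0,1]\<close>, with equality on the
  support. Finiteness of \<open>i\<close> puts \<open>0\<close> and \<open>1\<close> into the support. On a gap of the support,
  \<open>i'(x) = r ln (F(x - b) / F(x + b))\<close> is nonincreasing, so \<open>i\<close> is concave there; as \<open>c\<close> is
  strictly convex, a gap forces \<open>\<mu> = 0\<close> and then \<open>i\<close> is constant on \<open>[0,1]\<close>. In that case
  \<open>i' = 0\<close> says that the distribution function has vanishing second differences of step \<open>2b\<close> almost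
  everywhere on \<open>(0,1)\<close>, which determines it: the standard points carry at least the standard masses,
  so the cost is at least the critical cost, a contradiction.
\<close>

section \<open>Mutual information in terms of window probabilities\<close>

text \<open>The output density is \<open>rpar b\<close> times this probability; leaving the factor
  out is harmless because it cancels inside the logarithm.\<close>

definition window_prob :: "real \<Rightarrow> real measure \<Rightarrow> real \<Rightarrow> real" where
  "window_prob b p y = measure p {y - b<..<y + b}"

text \<open>Extended negative logarithm. Since \<open>ln 0 = 0\<close>, the infinite value at 0 is
  set by hand; 0 times infinity is 0 in \<open>ennreal\<close>, as entropy requires. On [0,1] the
  coercion truncates nothing.\<close>

definition surprisal :: "real \<Rightarrow> ennreal" where
  "surprisal t = (if t = 0 then \<infinity> else ennreal (- ln t))"

text \<open>Up to the factor \<open>rpar b\<close>, the mean under \<open>q\<close> of the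
  information density of \<open>p\<close>; on the diagonal this is the mutual information. It is
  affine in \<open>q\<close>.\<close>

definition cross_entropy :: "real \<Rightarrow> real measure \<Rightarrow> real measure \<Rightarrow> ennreal" where
  "cross_entropy b q p =
     (\<integral>\<^sup>+ y. ennreal (window_prob b q y) * surprisal (window_prob b p y) \<partial>lborel)"

lemma admissibleD:
  assumes "admissible p"
  shows "prob_space p" "sets p = sets borel" "space p = UNIV" "AE x in p. x \<in> {0..1}"
proof -
  show 1: "prob_space p" and 2: "sets p = sets borel"
    using assms by (auto simp: admissible_def)
  show 3: "space p = UNIV"
    using sets_eq_imp_space_eq[OF 2] by simp
  interpret prob_space p by fact
  have "prob {0..1} = 1"
    using assms by (auto simp: admissible_def measure_def)
  then show "AE x in p. x \<in> {0..1}"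
    using 2 by (subst (asm) prob_eq_1) auto
qed

lemma admissible_null:
  assumes "admissible p" "A \<in> sets borel" "A \<inter> {0..1} = {}"
  shows "measure p A = 0"
proof -
  interpret prob_space p using admissibleD[OF assms(1)] by blast
  have "AE x in p. x \<notin> A"
    using admissibleD(4)[OF assms(1)] by eventually_elim (use assms(3) in auto)
  then show ?thesis
    using assms(2) admissibleD(2)[OF assms(1)] prob_eq_0 by auto
qed

lemma window_prob_bounds:
  assumes "admissible p"
  shows "0 \<le> window_prob b p y" "window_prob b p y \<le> 1"
  using prob_space.prob_le_1[OF admissibleD(1)[OF assms]] by (auto simp: window_prob_def)

lemma window_prob_eq_0:
  assumes "admissible p" "y \<notin> {-b<..<1 + b}"
  shows "window_prob b p y = 0"
  unfolding window_prob_def by (rule admissible_null[OF assms(1)]) (use assms(2) in auto)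

lemma emeasure_window:
  assumes "admissible p"
  shows "emeasure p {y - b<..<y + b} = ennreal (window_prob b p y)"
proof -
  interpret prob_space p using admissibleD[OF assms] by blast
  show ?thesis by (simp add: window_prob_def emeasure_eq_measure)
qed

lemma window_swap: "x \<in> {y - b<..<y + b} \<longleftrightarrow> y \<in> {x - b<..<x + (b::real)}"
  by auto

text \<open>Fubini needs measurability jointly in the centre and the point, which is visible once
  membership is written as two comparisons.\<close>

lemma measurable_window_indicator [measurable]:
  "(\<lambda>z. indicator {f z - b<..<f z + b} (g z) :: ennreal) \<in> borel_measurable M"
  if [measurable]: "f \<in> borel_measurable M" "g \<in> borel_measurable M" for f g :: "_ \<Rightarrow> real"
proof -
  have "(\<lambda>z. indicator {f z - b<..<f z + b} (g z) :: ennreal)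
      = (\<lambda>z. if f z - b < g z \<and> g z < f z + b then 1 else 0)"
    by (auto simp: fun_eq_iff indicator_def)
  then show ?thesis by (simp only:) measurable
qed

lemma borel_measurable_window_prob [measurable]:
  assumes "admissible p"
  shows "window_prob b p \<in> borel_measurable borel"
proof -
  interpret prob_space p using admissibleD[OF assms] by blast
  note [measurable_cong] = admissibleD(2)[OF assms]
  have "(\<lambda>y. \<integral>\<^sup>+ x. indicator {y - b<..<y + b} x \<partial>p) \<in> borel_measurable borel"
    by measurable
  then have "(\<lambda>y. emeasure p {y - b<..<y + b}) \<in> borel_measurable borel"
    using admissibleD(2)[OF assms] by simp
  then show ?thesis
    unfolding window_prob_def[abs_def] measure_def by measurable
qed

lemma borel_measurable_surprisal [measurable]: "surprisal \<in> borel_measurable borel"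
  unfolding surprisal_def[abs_def] by measurable

lemma out_dens_eq:
  assumes "admissible p"
  shows "out_dens b p y = rpar b * window_prob b p y"
proof -
  interpret prob_space p using admissibleD[OF assms] by blast
  have "out_dens b p y = (\<integral>x. rpar b * indicator {y - b<..<y + b} x \<partial>p)"
    unfolding out_dens_def trans_dens_def using window_swap[of _ y b]
    by (intro Bochner_Integration.integral_cong refl) (auto simp: indicator_def)
  then show ?thesis
    using admissibleD[OF assms] by (simp add: window_prob_def)
qed

text \<open>Inside the window the factor \<open>rpar b\<close> cancels in the density ratio, leaving
  the reciprocal of the window probability; outside, the integrand is 0.\<close>

lemma info_dens_eq:
  assumes "admissible p" "b > 0"
  shows "info_dens b p x =
    ennreal (rpar b) * (\<integral>\<^sup>+ y. indicator {x - b<..<x + b} y * surprisal (window_prob b p y) \<partial>lborel)"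
proof -
  note [measurable] = borel_measurable_window_prob[OF assms(1)]
  have r: "rpar b > 0" using assms by (simp add: rpar_def)
  have eq: "(if trans_dens b x y = 0 then 0 else if out_dens b p y = 0 then \<infinity>
      else ennreal (trans_dens b x y * ln (trans_dens b x y / out_dens b p y)))
    = ennreal (rpar b) * (indicator {x - b<..<x + b} y * surprisal (window_prob b p y))" for y
    using r window_prob_bounds[OF assms(1), of b y]
    by (auto simp: trans_dens_def out_dens_eq[OF assms(1)] surprisal_def indicator_def
        ennreal_mult_top ennreal_mult'[symmetric] ln_div)
  show ?thesis
    unfolding info_dens_def eq by (rule nn_integral_cmult) measurable
qed

text \<open>Fubini for nonnegative functions: membership in a window is symmetric in centre and
  point, so integrating over \<open>x\<close> first leaves the window probability at
  \<open>y\<close>.\<close>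

lemma nn_integral_window:
  assumes "admissible q" and [measurable]: "f \<in> borel_measurable borel"
  shows "(\<integral>\<^sup>+ x. (\<integral>\<^sup>+ y. indicator {x - b<..<x + b} y * f y \<partial>lborel) \<partial>q)
    = (\<integral>\<^sup>+ y. ennreal (window_prob b q y) * f y \<partial>lborel)"
proof -
  interpret prob_space q using admissibleD[OF assms(1)] by blast
  interpret pair_sigma_finite q lborel ..
  note [measurable_cong] = admissibleD(2)[OF assms(1)]
  have "(\<integral>\<^sup>+ x. (\<integral>\<^sup>+ y. indicator {x - b<..<x + b} y * f y \<partial>lborel) \<partial>q)
      = (\<integral>\<^sup>+ y. (\<integral>\<^sup>+ x. indicator {x - b<..<x + b} y * f y \<partial>q) \<partial>lborel)"
    by (rule Fubini'[symmetric]) measurable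
  also have "\<dots> = (\<integral>\<^sup>+ y. (\<integral>\<^sup>+ x. f y * indicator {y - b<..<y + b} x \<partial>q) \<partial>lborel)"
    by (intro nn_integral_cong) (auto simp: indicator_def)
  also have "\<dots> = (\<integral>\<^sup>+ y. ennreal (window_prob b q y) * f y \<partial>lborel)"
    using admissibleD(2)[OF assms(1)]
    by (subst nn_integral_cmult_indicator) (auto simp: emeasure_window[OF assms(1)] mult.commute)
  finally show ?thesis .
qed

lemma nn_integral_info_dens:
  assumes "admissible p" "admissible q" "b > 0"
  shows "(\<integral>\<^sup>+ x. info_dens b p x \<partial>q) = ennreal (rpar b) * cross_entropy b q p"
proof -
  interpret prob_space q using admissibleD[OF assms(2)] by blast
  note [measurable] = borel_measurable_window_prob[OF assms(1)]
  note [measurable_cong] = admissibleD(2)[OF assms(2)]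
  show ?thesis
    unfolding info_dens_eq[OF assms(1,3)] cross_entropy_def
    by (subst nn_integral_window[symmetric, OF assms(2)], measurable)
      (rule assms, rule nn_integral_cmult, measurable)
qed

lemma borel_measurable_info_dens [measurable]:
  assumes "admissible p" "b > 0"
  shows "info_dens b p \<in> borel_measurable borel"
proof -
  note [measurable] = borel_measurable_window_prob[OF assms(1)]
  show ?thesis
    unfolding info_dens_eq[OF assms, abs_def] by measurable
qed

section \<open>Gibbs' inequality and finiteness of the mutual information\<close>

lemma nn_integral_window_prob:
  assumes "admissible p" "b > 0"
  shows "(\<integral>\<^sup>+ y. ennreal (window_prob b p y) \<partial>lborel) = ennreal (2 * b)"
proof -
  interpret prob_space p using admissibleD[OF assms(1)] by blast
  show ?thesis
    using nn_integral_window[OF assms(1), of "\<lambda>_. 1" b, symmetric] assms(2)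
    by (simp add: emeasure_space_1)
qed

text \<open>This is \<open>ln z \<le> z - 1\<close> at \<open>z = t / s\<close>, multiplied by
  \<open>s\<close>. Keeping \<open>s\<close> and \<open>t\<close> as summands avoids subtraction in
  \<open>ennreal\<close>.\<close>

lemma gibbs_pointwise:
  assumes "0 \<le> s" "s \<le> 1" "0 \<le> t" "t \<le> 1"
  shows "ennreal s * surprisal s + ennreal s \<le> ennreal s * surprisal t + ennreal t"
proof -
  consider "s = 0" | "s > 0" "t = 0" | "s > 0" "t > 0" using assms by linarith
  then show ?thesis
  proof cases
    case 3
    have "ln (t / s) \<le> t / s - 1" using 3 by (intro ln_le_minus_one) auto
    then have "s * ln (t / s) \<le> s * (t / s - 1)" using 3 by (intro mult_left_mono) auto
    then have "s * (- ln s) + s \<le> s * (- ln t) + t"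
      using 3 by (simp add: ln_div algebra_simps)
    moreover have "ln s \<le> 0" "ln t \<le> 0" using 3 assms by auto
    then have "0 \<le> s * (- ln s)" "0 \<le> s * (- ln t)" using 3 by (auto simp: mult_le_0_iff)
    ultimately have "ennreal (s * (- ln s)) + ennreal s \<le> ennreal (s * (- ln t)) + ennreal t"
      using 3 by (subst (1 2) ennreal_plus[symmetric]) (auto simp del: ennreal_plus)
    then show ?thesis
      using 3 by (simp add: surprisal_def ennreal_mult'[symmetric])
  qed (auto simp: surprisal_def ennreal_mult_top)
qed

text \<open>Every input has the same total window probability \<open>2 * b\<close>, so the extra
  summands of \<open>gibbs_pointwise\<close> integrate to a finite constant that cancels.\<close>

lemma gibbs:
  assumes "admissible p" "admissible q" "b > 0"
  shows "cross_entropy b p p \<le> cross_entropy b p q"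
proof -
  note [measurable] = borel_measurable_window_prob[OF assms(1)] borel_measurable_window_prob[OF assms(2)]
  have "cross_entropy b p p + ennreal (2 * b)
     = (\<integral>\<^sup>+ y. ennreal (window_prob b p y) * surprisal (window_prob b p y) + ennreal (window_prob b p y) \<partial>lborel)"
    unfolding cross_entropy_def nn_integral_window_prob[OF assms(1,3), symmetric]
    by (rule nn_integral_add[symmetric]) measurable
  also have "\<dots> \<le> (\<integral>\<^sup>+ y. ennreal (window_prob b p y) * surprisal (window_prob b q y) + ennreal (window_prob b q y) \<partial>lborel)"
    by (intro nn_integral_mono gibbs_pointwise window_prob_bounds assms)
  also have "\<dots> = cross_entropy b p q + ennreal (2 * b)"
    unfolding cross_entropy_def nn_integral_window_prob[OF assms(2,3), symmetric]
    by (rule nn_integral_add) measurable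
  finally show ?thesis
    by (simp add: add.commute[of _ "ennreal (2 * b)"])
qed

text \<open>Taking \<open>t = 1\<close> in \<open>gibbs_pointwise\<close> bounds the integrand by 1,
  and it vanishes outside a bounded interval.\<close>

lemma cross_entropy_self_finite:
  assumes "admissible p" "b > 0"
  shows "cross_entropy b p p < \<infinity>"
proof -
  have 1: "ennreal (window_prob b p y) * surprisal (window_prob b p y) \<le> indicator {-b<..<1 + b} y" for y
  proof (cases "y \<in> {-b<..<1 + b}")
    case True
    then show ?thesis
      using gibbs_pointwise[of "window_prob b p y" 1] window_prob_bounds[OF assms(1), of b y]
      by (auto simp: surprisal_def intro: order.trans[OF add_increasing2])
  qed (simp add: window_prob_eq_0[OF assms(1)])
  have "cross_entropy b p p \<le> (\<integral>\<^sup>+ y. indicator {-b<..<1 + b} y \<partial>lborel)"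
    unfolding cross_entropy_def by (intro nn_integral_mono 1)
  also have "\<dots> < \<infinity>" using assms(2) by simp
  finally show ?thesis .
qed

section \<open>First-order optimality\<close>

text \<open>A Bernoulli choice followed by a draw, so that integrals come from the monadic bind; the
  weight \<open>t\<close> belongs to \<open>q\<close>.\<close>

definition mixture :: "real \<Rightarrow> real measure \<Rightarrow> real measure \<Rightarrow> real measure" where
  "mixture t p q = measure_pmf (bernoulli_pmf t) \<bind> (\<lambda>c. if c then q else p)"

lemma mixture_kernel:
  assumes "admissible p" "admissible q"
  shows "(\<lambda>c. if c then q else p) \<in> measurable (measure_pmf (bernoulli_pmf t)) (subprob_algebra borel)"
  using admissibleD[OF assms(1)] admissibleD[OF assms(2)]
  by (auto simp: space_subprob_algebra prob_space_imp_subprob_space)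

lemma nn_integral_mixture:
  assumes "admissible p" "admissible q" "0 \<le> t" "t \<le> 1" "f \<in> borel_measurable borel"
  shows "(\<integral>\<^sup>+ x. f x \<partial>mixture t p q) = ennreal (1 - t) * (\<integral>\<^sup>+ x. f x \<partial>p) + ennreal t * (\<integral>\<^sup>+ x. f x \<partial>q)"
  unfolding mixture_def using assms
  by (subst nn_integral_bind[OF assms(5) mixture_kernel[OF assms(1,2)]])
    (simp add: mult.commute add.commute)

lemma sets_mixture:
  assumes "admissible p" "admissible q"
  shows "sets (mixture t p q) = sets borel"
  unfolding mixture_def by (rule sets_bind_measurable[OF mixture_kernel[OF assms]]) simp

lemma emeasure_mixture:
  assumes "admissible p" "admissible q" "0 \<le> t" "t \<le> 1" "A \<in> sets borel"
  shows "emeasure (mixture t p q) A = ennreal (1 - t) * emeasure p A + ennreal t * emeasure q A"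
  using nn_integral_mixture[OF assms(1-4), of "indicator A"] assms(5)
  by (simp add: sets_mixture[OF assms(1,2)] admissibleD(2)[OF assms(1)] admissibleD(2)[OF assms(2)])

lemma admissible_mixture:
  assumes "admissible p" "admissible q" "0 \<le> t" "t \<le> 1"
  shows "admissible (mixture t p q)"
proof -
  have "prob_space (mixture t p q)"
    unfolding mixture_def using admissibleD(1)[OF assms(1)] admissibleD(1)[OF assms(2)]
    by (intro measure_pmf.prob_space_bind[OF _ mixture_kernel[OF assms(1,2)]]) auto
  moreover have "emeasure (mixture t p q) {0..1} = 1"
    using assms by (subst emeasure_mixture)
      (auto simp: admissible_def ennreal_plus[symmetric] simp del: ennreal_plus)
  ultimately show ?thesis
    using sets_mixture[OF assms(1,2)] by (auto simp: admissible_def)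
qed

lemma window_prob_mixture:
  assumes "admissible p" "admissible q" "0 \<le> t" "t \<le> 1"
  shows "window_prob b (mixture t p q) y = (1 - t) * window_prob b p y + t * window_prob b q y"
proof -
  have "ennreal (window_prob b (mixture t p q) y)
      = ennreal (1 - t) * ennreal (window_prob b p y) + ennreal t * ennreal (window_prob b q y)"
    unfolding emeasure_window[OF admissible_mixture[OF assms], symmetric]
      emeasure_window[OF assms(1), symmetric] emeasure_window[OF assms(2), symmetric]
    by (rule emeasure_mixture[OF assms]) simp
  also have "\<dots> = ennreal ((1 - t) * window_prob b p y + t * window_prob b q y)"
    using assms window_prob_bounds(1)[OF assms(1), of b y] window_prob_bounds(1)[OF assms(2), of b y]
    by (simp add: ennreal_mult'[symmetric] ennreal_plus[symmetric] del: ennreal_plus)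
  finally show ?thesis
    using assms window_prob_bounds(1)[OF assms(1), of b y] window_prob_bounds(1)[OF assms(2), of b y]
      window_prob_bounds(1)[OF admissible_mixture[OF assms], of b y]
    by (subst (asm) ennreal_inj) auto
qed

lemma admissible_return:
  assumes "x \<in> {0..1}"
  shows "admissible (return borel x)"
  using assms by (auto simp: admissible_def prob_space_return)

lemma borel_measurable_cost [measurable]: "cost \<alpha> \<in> borel_measurable borel"
  unfolding cost_def[abs_def] by measurable

lemma cost_bounds:
  assumes "x \<in> {0..1}" "\<alpha> > 0"
  shows "0 \<le> cost \<alpha> x" "cost \<alpha> x \<le> 1"
  using assms by (auto simp: cost_def powr_le1)

lemma integrable_cost:
  assumes "admissible p" "\<alpha> > 0"
  shows "integrable p (cost \<alpha>)"
proof -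
  interpret prob_space p using admissibleD[OF assms(1)] by blast
  note [measurable_cong] = admissibleD(2)[OF assms(1)]
  show ?thesis
    using admissibleD(4)[OF assms(1)] cost_bounds[OF _ assms(2)]
    by (intro integrable_const_bound[where B=1]) (auto elim: eventually_mono)
qed

lemma feasible_iff_nn_integral:
  assumes "\<alpha> > 0" "cbar \<ge> 0"
  shows "feasible \<alpha> cbar p \<longleftrightarrow> admissible p \<and> (\<integral>\<^sup>+ x. ennreal (cost \<alpha> x) \<partial>p) \<le> ennreal cbar"
proof (cases "admissible p")
  case True
  have "(\<integral>\<^sup>+ x. ennreal (cost \<alpha> x) \<partial>p) = ennreal (\<integral>x. cost \<alpha> x \<partial>p)"
    by (rule nn_integral_eq_integral[OF integrable_cost[OF True assms(1)]]) (simp add: cost_def)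
  then show ?thesis
    using True assms by (simp add: feasible_def)
qed (simp add: feasible_def)

lemma feasible_mixture:
  assumes "feasible \<alpha> cbar p" "feasible \<alpha> cbar q" "0 \<le> t" "t \<le> 1" "\<alpha> > 0" "cbar \<ge> 0"
  shows "feasible \<alpha> cbar (mixture t p q)"
proof -
  note f = feasible_iff_nn_integral[OF assms(5,6)]
  have adm: "admissible p" "admissible q" using assms f by auto
  have "(\<integral>\<^sup>+ x. ennreal (cost \<alpha> x) \<partial>mixture t p q)
      = ennreal (1 - t) * (\<integral>\<^sup>+ x. ennreal (cost \<alpha> x) \<partial>p) + ennreal t * (\<integral>\<^sup>+ x. ennreal (cost \<alpha> x) \<partial>q)"
    by (rule nn_integral_mixture[OF adm assms(3,4)]) measurable
  also have "\<dots> \<le> ennreal (1 - t) * ennreal cbar + ennreal t * ennreal cbar"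
    using assms f by (intro add_mono mult_left_mono) auto
  also have "\<dots> = ennreal ((1 - t) * cbar + t * cbar)"
    using assms by (simp add: ennreal_mult'[symmetric] ennreal_plus[symmetric] del: ennreal_plus)
  also have "\<dots> = ennreal cbar" by (simp add: algebra_simps)
  finally show ?thesis
    using f admissible_mixture[OF adm assms(3,4)] by blast
qed

lemma mutual_info_eq:
  assumes "admissible p" "b > 0"
  shows "mutual_info b p = ennreal (rpar b) * cross_entropy b p p"
  unfolding mutual_info_def by (rule nn_integral_info_dens[OF assms(1,1,2)])

lemma rpar_pos: "b > 0 \<Longrightarrow> rpar b > 0"
  by (simp add: rpar_def)

lemma cross_entropy_mixture_left:
  assumes "admissible p" "admissible q" "admissible s" "0 \<le> t" "t \<le> 1"
  shows "cross_entropy b (mixture t p q) s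
    = ennreal (1 - t) * cross_entropy b p s + ennreal t * cross_entropy b q s"
proof -
  note [measurable] = borel_measurable_window_prob[OF assms(1)]
    borel_measurable_window_prob[OF assms(2)] borel_measurable_window_prob[OF assms(3)]
  have eq: "ennreal (window_prob b (mixture t p q) y) * e
      = ennreal (1 - t) * (ennreal (window_prob b p y) * e) + ennreal t * (ennreal (window_prob b q y) * e)" for y e
    using assms window_prob_bounds(1)[OF assms(1), of b y] window_prob_bounds(1)[OF assms(2), of b y]
    by (simp add: window_prob_mixture distrib_right ennreal_mult mult.assoc)
  show ?thesis
    unfolding cross_entropy_def eq
    by (subst nn_integral_add, measurable) (subst (1 2) nn_integral_cmult; measurable; simp)
qed

text \<open>The infinite value at 0 makes \<open>surprisal\<close> continuous there; positive terms
  keep the sequence on the logarithmic branch.\<close>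

lemma tendsto_surprisal:
  assumes "F \<longlonglongrightarrow> t" "\<And>n. 0 < F n"
  shows "(\<lambda>n. surprisal (F n)) \<longlonglongrightarrow> surprisal t"
proof (cases "t = 0")
  case True
  have "filterlim F (at_right 0) sequentially"
    using assms True by (auto simp: filterlim_at less_imp_neq[symmetric])
  then have "filterlim (\<lambda>n. - ln (F n)) at_top sequentially"
    by (intro filterlim_uminus_at_bot[THEN iffD1, unfolded o_def] filterlim_compose[OF ln_at_0]) auto
  then have "(\<lambda>n. ennreal (- ln (F n))) \<longlonglongrightarrow> \<infinity>"
    by (rule ennreal_tendsto_top_eq_at_top[THEN iffD2, unfolded infinity_ennreal_def[symmetric]])
  then show ?thesis
    using True assms(2) by (simp add: surprisal_def less_imp_neq[symmetric])
next
  case False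
  then have "(\<lambda>n. ennreal (- ln (F n))) \<longlonglongrightarrow> ennreal (- ln t)"
    by (intro tendsto_intros assms)
  then show ?thesis
    using False assms(2) by (simp add: surprisal_def less_imp_neq[symmetric])
qed

text \<open>First-order optimality: \<open>p\<close> is compared with its mixtures with \<open>q\<close>; letting the weight of
  \<open>q\<close> tend to \<open>0\<close>, Fatou's lemma also covers an infinite directional derivative.\<close>

lemma capacity_achieving_cross_entropy_le:
  assumes "capacity_achieving b \<alpha> cbar p" "feasible \<alpha> cbar q" "b > 0" "\<alpha> > 0" "cbar \<ge> 0"
  shows "cross_entropy b q p \<le> cross_entropy b p p"
proof -
  have fp: "feasible \<alpha> cbar p" using assms by (auto simp: capacity_achieving_def)
  have adm: "admissible p" "admissible q" using fp assms by (auto simp: feasible_def)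
  have *: "cross_entropy b q (mixture t p q) \<le> cross_entropy b p p" if t: "0 < t" "t < 1" for t
  proof -
    let ?m = "mixture t p q"
    have am: "admissible ?m" using adm t by (intro admissible_mixture) auto
    have "feasible \<alpha> cbar ?m" using assms fp t by (intro feasible_mixture) auto
    then have "mutual_info b ?m \<le> mutual_info b p"
      using assms(1) by (auto simp: capacity_achieving_def)
    then have le: "cross_entropy b ?m ?m \<le> cross_entropy b p p"
      using rpar_pos[OF assms(3)]
      by (simp add: mutual_info_eq am adm assms(3) ennreal_mult_le_mult_iff)
    \<comment> \<open>Gibbs' inequality replaces \<open>cross_entropy b p ?m\<close> by the finite
      \<open>cross_entropy b p p\<close>, which then cancels against the same term on the
      right.\<close>
    have "ennreal (1 - t) * cross_entropy b p p + ennreal t * cross_entropy b q ?m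
        \<le> ennreal (1 - t) * cross_entropy b p ?m + ennreal t * cross_entropy b q ?m"
      by (intro add_mono mult_left_mono gibbs adm am assms) auto
    also have "\<dots> = cross_entropy b ?m ?m"
      using t by (intro cross_entropy_mixture_left[symmetric] adm am) auto
    also have "\<dots> \<le> cross_entropy b p p" by (rule le)
    also have "\<dots> = ennreal (1 - t) * cross_entropy b p p + ennreal t * cross_entropy b p p"
      using t by (simp add: distrib_right[symmetric] ennreal_plus[symmetric] del: ennreal_plus)
    finally have "ennreal t * cross_entropy b q ?m \<le> ennreal t * cross_entropy b p p"
      using cross_entropy_self_finite[OF adm(1) assms(3)]
      by (subst (asm) ennreal_add_left_cancel_le) (auto simp: ennreal_mult_eq_top_iff)
    then show ?thesis
      using t by (simp add: ennreal_mult_le_mult_iff)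
  qed
  define t where "t n = 1 / (real n + 2)" for n
  have t: "0 < t n" "t n < 1" for n by (auto simp: t_def)
  have t0: "t \<longlonglongrightarrow> 0" unfolding t_def by real_asymp
  define f where "f n y = ennreal (window_prob b q y) * surprisal (window_prob b (mixture (t n) p q) y)" for n y
  \<comment> \<open>Where \<open>q\<close> has window probability 0 both sides vanish; elsewhere
    \<open>q\<close> keeps the window probability of every mixture positive.\<close>
  have lim: "(\<lambda>n. f n y) \<longlonglongrightarrow> ennreal (window_prob b q y) * surprisal (window_prob b p y)" for y
  proof (cases "window_prob b q y = 0")
    case False
    then have pos: "window_prob b q y > 0" using window_prob_bounds(1)[OF adm(2), of b y] by simp
    have m: "window_prob b (mixture (t n) p q) y = (1 - t n) * window_prob b p y + t n * window_prob b q y" for n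
      using t[of n] by (intro window_prob_mixture adm) auto
    have "(\<lambda>n. window_prob b (mixture (t n) p q) y) \<longlonglongrightarrow> (1 - 0) * window_prob b p y + 0 * window_prob b q y"
      unfolding m by (intro tendsto_intros t0)
    moreover have "0 < window_prob b (mixture (t n) p q) y" for n
      unfolding m using t[of n] pos window_prob_bounds(1)[OF adm(1), of b y]
      by (intro add_nonneg_pos mult_nonneg_nonneg mult_pos_pos) auto
    ultimately have "(\<lambda>n. surprisal (window_prob b (mixture (t n) p q) y)) \<longlonglongrightarrow> surprisal (window_prob b p y)"
      by (intro tendsto_surprisal) auto
    then show ?thesis
      unfolding f_def using pos by (intro ennreal_tendsto_cmult) auto
  qed (simp add: f_def)
  have meas [measurable]: "f n \<in> borel_measurable lborel" for n
    using borel_measurable_window_prob[OF adm(2), of b]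
      borel_measurable_window_prob[OF admissible_mixture[OF adm, of "t n"], of b] t[of n]
    unfolding f_def[abs_def] by simp
  have "cross_entropy b q p = (\<integral>\<^sup>+ y. liminf (\<lambda>n. f n y) \<partial>lborel)"
    unfolding cross_entropy_def
    using lim by (intro nn_integral_cong lim_imp_Liminf[symmetric]) auto
  also have "\<dots> \<le> liminf (\<lambda>n. \<integral>\<^sup>+ y. f n y \<partial>lborel)"
    by (rule nn_integral_liminf) measurable
  also have "\<dots> \<le> liminf (\<lambda>n. cross_entropy b p p)"
    using *[OF t] by (intro Liminf_mono) (auto simp: f_def cross_entropy_def)
  finally show ?thesis by (simp add: Liminf_const)
qed

section \<open>Lagrange multiplier\<close>

text \<open>In the plane of pairs (g, f), the two-point hypothesis says that slopes from (c, m) to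
  points right of c never exceed slopes to points left of c. The supremum of the right slopes is
  thus a multiplier; the Slater point \<open>z\<close> keeps it finite.\<close>

lemma lagrange_multiplier:
  fixes f g :: "'a \<Rightarrow> real"
  assumes z: "z \<in> S" "g z < c"
    and le: "\<And>x y t. x \<in> S \<Longrightarrow> y \<in> S \<Longrightarrow> 0 \<le> t \<Longrightarrow> t \<le> 1 \<Longrightarrow>
      (1 - t) * g y + t * g x \<le> c \<Longrightarrow> (1 - t) * f y + t * f x \<le> m"
  shows "\<exists>\<mu>\<ge>0. \<forall>x\<in>S. f x - m \<le> \<mu> * (g x - c)"
proof -
  \<comment> \<open>The inserted 0 makes the set nonempty and its supremum nonnegative.\<close>
  define Q where "Q = insert 0 ((\<lambda>x. (f x - m) / (g x - c)) ` {x \<in> S. g x > c})"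
  have low: "f y \<le> m" if "y \<in> S" "g y \<le> c" for y
    using le[of y y 0] that by simp
  have ub: "s \<le> (m - f y) / (c - g y)" if s: "s \<in> Q" and y: "y \<in> S" "g y < c" for s y
  proof (cases "s = 0")
    case False
    then obtain x where x: "x \<in> S" "g x > c" "s = (f x - m) / (g x - c)"
      using s by (auto simp: Q_def)
    \<comment> \<open>The weight at which the mixed constraint holds with equality.\<close>
    define t where "t = (c - g y) / (g x - g y)"
    have t: "0 \<le> t" "t \<le> 1"
      using x y by (auto simp: t_def field_simps)
    have tg: "t * (g x - g y) = c - g y"
      using x y by (simp add: t_def)
    then have "(1 - t) * g y + t * g x = c"
      by (simp add: algebra_simps)
    then have "(1 - t) * f y + t * f x \<le> m"
      using le[of x y t] x y t by simp
    then have "((1 - t) * f y + t * f x) * (g x - g y) \<le> m * (g x - g y)"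
      using x y by (intro mult_right_mono) auto
    then have "f y * (g x - g y) + (t * (g x - g y)) * (f x - f y) \<le> m * (g x - g y)"
      by (simp add: algebra_simps)
    then have "(g x - c) * f y + (c - g y) * f x \<le> m * (g x - g y)"
      unfolding tg by (simp add: algebra_simps)
    then show ?thesis
      unfolding x(3) using x y by (simp add: field_simps)
  qed (use low[of y] y in auto)
  have bdd: "bdd_above Q" by (rule bdd_aboveI) (rule ub[OF _ z])
  have Q0: "0 \<in> Q" by (simp add: Q_def)
  show ?thesis
  proof (intro exI[of _ "Sup Q"] conjI ballI)
    show "0 \<le> Sup Q" using cSup_upper[OF Q0 bdd] .
    fix x assume x: "x \<in> S"
    consider "g x < c" | "g x = c" | "g x > c" by linarith
    then show "f x - m \<le> Sup Q * (g x - c)"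
    proof cases
      case 1
      have "Sup Q \<le> (m - f x) / (c - g x)"
        using Q0 ub[OF _ x 1] by (intro cSup_least) auto
      then show ?thesis using 1 by (simp add: field_simps)
    next
      case 2
      then show ?thesis using low[OF x] by simp
    next
      case 3
      then have "(f x - m) / (g x - c) \<le> Sup Q"
        using x by (intro cSup_upper bdd) (auto simp: Q_def)
      then show ?thesis using 3 by (simp add: field_simps)
    qed
  qed
qed

section \<open>Optimality conditions for a fixed maximizer\<close>

locale optimal_input =
  fixes b \<alpha> cbar :: real and p :: "real measure"
  assumes b_pos: "b > 0" and alpha_gt_1: "\<alpha> > 1" and cbar_pos: "0 < cbar"
    and opt: "capacity_achieving b \<alpha> cbar p"
begin

lemma feas: "feasible \<alpha> cbar p"
  using opt by (simp add: capacity_achieving_def)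

lemma adm: "admissible p"
  using feas by (simp add: feasible_def)

sublocale prob_space p
  by (rule admissibleD(1)[OF adm])

lemma sets_p [measurable_cong]: "sets p = sets borel"
  by (rule admissibleD(2)[OF adm])

sublocale finite_borel_measure p
  by unfold_locales (simp_all add: sets_p)

lemma alpha_pos: "\<alpha> > 0"
  using alpha_gt_1 by simp

lemmas measurable_F [measurable] = borel_measurable_window_prob[OF adm, of b]
lemmas measurable_info [measurable] = borel_measurable_info_dens[OF adm b_pos]

definition info :: "real \<Rightarrow> real" where
  "info x = enn2real (info_dens b p x)"

definition cap :: real where
  "cap = enn2real (mutual_info b p)"

lemma mutual_info_finite: "mutual_info b p < \<infinity>"
  using cross_entropy_self_finite[OF adm b_pos]
  by (simp add: mutual_info_eq[OF adm b_pos] ennreal_mult_less_top)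

lemma ennreal_cap: "ennreal cap = mutual_info b p"
  using mutual_info_finite by (simp add: cap_def)

text \<open>First-order optimality against the input with mass \<open>1 - t\<close> at
  \<open>y\<close> and mass \<open>t\<close> at \<open>x\<close>.\<close>

lemma two_point_info_le:
  assumes "x \<in> {0..1}" "y \<in> {0..1}" "0 \<le> t" "t \<le> 1"
    and "(1 - t) * cost \<alpha> y + t * cost \<alpha> x \<le> cbar"
  shows "ennreal (1 - t) * info_dens b p y + ennreal t * info_dens b p x \<le> mutual_info b p"
proof -
  let ?q = "mixture t (return borel y) (return borel x)"
  note adm' = admissible_return[OF assms(2)] admissible_return[OF assms(1)]
  have q: "admissible ?q" by (rule admissible_mixture[OF adm' assms(3,4)])
  have "(\<integral>\<^sup>+ u. ennreal (cost \<alpha> u) \<partial>?q) = ennreal ((1 - t) * cost \<alpha> y + t * cost \<alpha> x)"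
    using assms cost_bounds[OF assms(1) alpha_pos] cost_bounds[OF assms(2) alpha_pos]
    by (subst nn_integral_mixture[OF adm' assms(3,4)])
      (auto simp: nn_integral_return ennreal_mult'[symmetric] ennreal_plus[symmetric] simp del: ennreal_plus)
  then have "feasible \<alpha> cbar ?q"
    using q assms(5) feasible_iff_nn_integral[OF alpha_pos, of cbar ?q] cbar_pos
    by (auto intro: ennreal_leI)
  then have "cross_entropy b ?q p \<le> cross_entropy b p p"
    by (rule capacity_achieving_cross_entropy_le[OF opt _ b_pos alpha_pos]) (use cbar_pos in simp)
  then have "(\<integral>\<^sup>+ u. info_dens b p u \<partial>?q) \<le> mutual_info b p"
    unfolding nn_integral_info_dens[OF adm q b_pos] mutual_info_eq[OF adm b_pos]
    by (intro mult_left_mono) auto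
  then show ?thesis
    by (subst (asm) nn_integral_mixture[OF adm' assms(3,4)]) (auto simp: nn_integral_return)
qed

text \<open>The point 0 is free of cost, so mass \<open>t\<close> at \<open>x\<close> with the rest
  at 0 is feasible for small \<open>t\<close>; this bounds the density at \<open>x\<close> by the
  mutual information divided by \<open>t\<close>.\<close>

lemma info_dens_finite:
  assumes "x \<in> {0..1}"
  shows "info_dens b p x < \<infinity>"
proof -
  \<comment> \<open>Costs on [0,1] are at most 1, so this weight respects the budget.\<close>
  define t where "t = min 1 cbar"
  have t: "0 < t" "t \<le> 1" using cbar_pos by (auto simp: t_def)
  have "t * cost \<alpha> x \<le> t" using cost_bounds[OF assms alpha_pos] t by (simp add: mult_left_le)
  then have "ennreal (1 - t) * info_dens b p 0 + ennreal t * info_dens b p x \<le> mutual_info b p"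
    using t assms by (intro two_point_info_le) (auto simp: cost_def t_def)
  then have "ennreal t * info_dens b p x \<le> mutual_info b p"
    by (rule order.trans[rotated]) simp
  then have "ennreal t * info_dens b p x < \<infinity>" using mutual_info_finite by (rule order.strict_trans1)
  then show ?thesis
    using t by (auto simp: ennreal_mult_less_top)
qed

lemma ennreal_info: "x \<in> {0..1} \<Longrightarrow> ennreal (info x) = info_dens b p x"
  using info_dens_finite[of x] by (simp add: info_def)

lemma info_nonneg: "0 \<le> info x"
  by (simp add: info_def)

lemma exists_multiplier: "\<exists>\<mu>\<ge>0. \<forall>x\<in>{0..1}. info x - cap \<le> \<mu> * (cost \<alpha> x - cbar)"
proof (rule lagrange_multiplier)
  show "(0::real) \<in> {0..1}" "cost \<alpha> 0 < cbar" using cbar_pos by (auto simp: cost_def)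
  fix x y t :: real
  assume *: "x \<in> {0..1}" "y \<in> {0..1}" "0 \<le> t" "t \<le> 1" "(1 - t) * cost \<alpha> y + t * cost \<alpha> x \<le> cbar"
  have "ennreal ((1 - t) * info y + t * info x) \<le> ennreal cap"
    using two_point_info_le[OF *] * info_nonneg
    by (simp add: ennreal_mult ennreal_info ennreal_cap)
  then show "(1 - t) * info y + t * info x \<le> cap"
    by (subst (asm) ennreal_le_iff) (simp_all add: cap_def)
qed

text \<open>The slack in the multiplier inequality is nonnegative, and its mean is at most 0 because
  the mean of \<open>info\<close> is \<open>cap\<close> and the mean cost is at most
  \<open>cbar\<close>.\<close>

lemma AE_complementary_slackness:
  assumes "\<mu> \<ge> 0" "\<forall>x\<in>{0..1}. info x - cap \<le> \<mu> * (cost \<alpha> x - cbar)"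
  shows "AE x in p. info x - cap = \<mu> * (cost \<alpha> x - cbar)"
proof -
  note A = admissibleD(4)[OF adm]
  have [measurable]: "info \<in> borel_measurable p" unfolding info_def[abs_def] by measurable
  have nn: "(\<integral>\<^sup>+ x. ennreal (info x) \<partial>p) = ennreal cap"
    unfolding ennreal_cap mutual_info_def
    by (rule nn_integral_cong_AE) (use A in eventually_elim, rule ennreal_info)
  have int: "integrable p info"
    by (rule integrableI_nonneg) (auto simp: info_nonneg nn)
  have "ennreal (\<integral>x. info x \<partial>p) = ennreal cap"
    using nn_integral_eq_integral[OF int] nn info_nonneg by simp
  then have I: "(\<integral>x. info x \<partial>p) = cap"
    using info_nonneg by (subst (asm) ennreal_inj) (auto simp: cap_def)
  let ?g = "\<lambda>x. \<mu> * (cost \<alpha> x - cbar) - (info x - cap)"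
  have ig: "integrable p ?g"
    using int integrable_cost[OF adm alpha_pos] by simp
  have nng: "AE x in p. 0 \<le> ?g x"
    using A by eventually_elim (use assms(2) in auto)
  have "(\<integral>x. ?g x \<partial>p) = \<mu> * ((\<integral>x. cost \<alpha> x \<partial>p) - cbar)"
    using int integrable_cost[OF adm alpha_pos] by (simp add: I prob_space)
  also have "\<dots> \<le> 0"
    using assms(1) feas by (auto simp: feasible_def mult_nonneg_nonpos)
  finally have "(\<integral>x. ?g x \<partial>p) = 0"
    using integral_nonneg_AE[OF nng] by simp
  then have "AE x in p. ?g x = 0"
    using integral_nonneg_eq_0_iff_AE[OF ig nng] by simp
  then show ?thesis by eventually_elim simp
qed

text \<open>On \<open>{-b<..<1 + b}\<close> this is the negative logarithm of the window probability, almost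
  everywhere finite; off that set the window probability is \<open>0\<close> and \<open>ln 0 = 0\<close>.\<close>

definition neglog :: "real \<Rightarrow> real" where
  "neglog y = - ln (window_prob b p y)"

lemma neglog_nonneg: "0 \<le> neglog y"
  using window_prob_bounds[OF adm, of b y]
  by (cases "window_prob b p y = 0") (auto simp: neglog_def)

lemma measurable_neglog [measurable]: "neglog \<in> borel_measurable borel"
  unfolding neglog_def[abs_def] by measurable

section \<open>Integrability of the logarithm of the window probability\<close>

lemma nn_integral_surprisal_window_finite:
  assumes "x \<in> {0..1}"
  shows "(\<integral>\<^sup>+ y. indicator {x - b<..<x + b} y * surprisal (window_prob b p y) \<partial>lborel) < \<infinity>"
  using info_dens_finite[OF assms] rpar_pos[OF b_pos]
  by (auto simp: info_dens_eq[OF adm b_pos] ennreal_mult_less_top)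

text \<open>Finitely many windows centred in [0,1] cover the output range, and each contributes a
  finite information density.\<close>

lemma nn_integral_surprisal_finite:
  "(\<integral>\<^sup>+ y. indicator {-b<..<1 + b} y * surprisal (window_prob b p y) \<partial>lborel) < \<infinity>"
proof -
  define N where "N = nat \<lceil>1 / b\<rceil>"
  \<comment> \<open>Centres at spacing \<open>b\<close>, capped at 1, have overlapping windows; the
    last centre is exactly 1.\<close>
  define u where "u k = min 1 (real k * b)" for k
  have u: "u k \<in> {0..1}" for k using b_pos by (auto simp: u_def)
  have cover: "\<exists>k\<le>N. y \<in> {u k - b<..<u k + b}" if y: "y \<in> {-b<..<1 + b}" for y
  proof -
    have "1 / b \<le> real N" unfolding N_def by linarith
    then have N: "u N = 1" using b_pos by (simp add: u_def field_simps)
    consider "y \<le> 0" | "y \<ge> 1" | "0 < y" "y < 1" by linarith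
    then show ?thesis
    proof cases
      case 1
      then show ?thesis using y b_pos by (intro exI[of _ 0]) (auto simp: u_def)
    next
      case 2
      then show ?thesis using y b_pos N by (intro exI[of _ N]) auto
    next
      case 3
      define k where "k = nat \<lfloor>y / b\<rfloor>"
      have pos: "0 \<le> y / b" using 3 b_pos by simp
      have "real k \<le> y / b" "y / b < real k + 1" using pos unfolding k_def by linarith+
      then have k: "real k * b \<le> y" "y < real k * b + b" using b_pos by (simp_all add: field_simps)
      have "y / b \<le> 1 / b" using 3 b_pos by (simp add: field_simps)
      then have "k \<le> N" unfolding k_def N_def by (intro nat_mono) linarith
      then show ?thesis using k 3 b_pos by (intro exI[of _ k]) (auto simp: u_def)
    qed
  qed
  have "(\<integral>\<^sup>+ y. indicator {-b<..<1 + b} y * surprisal (window_prob b p y) \<partial>lborel)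
    \<le> (\<integral>\<^sup>+ y. (\<Sum>k\<le>N. indicator {u k - b<..<u k + b} y * surprisal (window_prob b p y)) \<partial>lborel)"
  proof (intro nn_integral_mono)
    fix y
    show "indicator {-b<..<1 + b} y * surprisal (window_prob b p y)
      \<le> (\<Sum>k\<le>N. indicator {u k - b<..<u k + b} y * surprisal (window_prob b p y))"
    proof (cases "y \<in> {-b<..<1 + b}")
      case True
      then obtain k where "k \<le> N" "y \<in> {u k - b<..<u k + b}" using cover by blast
      then show ?thesis using True
        by (intro order.trans[OF _ member_le_sum[of k]]) auto
    qed simp
  qed
  also have "\<dots> = (\<Sum>k\<le>N. \<integral>\<^sup>+ y. indicator {u k - b<..<u k + b} y * surprisal (window_prob b p y) \<partial>lborel)"
    by (rule nn_integral_sum) measurable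
  also have "\<dots> < \<infinity>"
    using nn_integral_surprisal_window_finite[OF u] by (simp add: ennreal_sum_less_top less_top[symmetric])
  finally show ?thesis .
qed

lemma AE_window_prob_pos: "AE y in lborel. y \<in> {-b<..<1 + b} \<longrightarrow> 0 < window_prob b p y"
proof -
  have "AE y in lborel. indicator {-b<..<1 + b} y * surprisal (window_prob b p y) \<noteq> \<infinity>"
    using nn_integral_surprisal_finite by (intro nn_integral_noteq_infinite) auto
  then show ?thesis
  proof eventually_elim
    case (elim y)
    then show ?case
      using window_prob_bounds(1)[OF adm, of b y] by (cases "window_prob b p y = 0") (auto simp: surprisal_def)
  qed
qed

lemma integrable_neglog: "integrable lborel neglog"
proof (rule integrableI_nonneg)
  have "(\<integral>\<^sup>+ y. ennreal (neglog y) \<partial>lborel)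
      \<le> (\<integral>\<^sup>+ y. indicator {-b<..<1 + b} y * surprisal (window_prob b p y) \<partial>lborel)"
  proof (intro nn_integral_mono)
    fix y
    show "ennreal (neglog y) \<le> indicator {-b<..<1 + b} y * surprisal (window_prob b p y)"
      using window_prob_eq_0[OF adm, of y b]
      by (cases "y \<in> {-b<..<1 + b}") (auto simp: neglog_def surprisal_def)
  qed
  then show "(\<integral>\<^sup>+ y. ennreal (neglog y) \<partial>lborel) < \<infinity>"
    using nn_integral_surprisal_finite by (rule order.strict_trans1)
qed (auto simp: neglog_nonneg)

lemma neglog_integrable_on: "neglog integrable_on {u..v}"
  and set_integral_neglog: "(LINT y:{u<..<v}|lborel. neglog y) = integral {u..v} neglog"
proof -
  have "set_integrable lborel A neglog" if "A \<in> sets borel" for A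
    unfolding set_integrable_def using integrable_neglog that
    by (intro integrable_mult_indicator) auto
  from set_borel_integral_eq_integral[OF this]
  show "neglog integrable_on {u..v}" "(LINT y:{u<..<v}|lborel. neglog y) = integral {u..v} neglog"
    by (auto simp: integral_open_interval_real)
qed

lemma info_eq_integral:
  assumes "x \<in> {0..1}"
  shows "info x = rpar b * integral {x - b..x + b} neglog"
proof -
  have "(\<integral>\<^sup>+ y. indicator {x - b<..<x + b} y * surprisal (window_prob b p y) \<partial>lborel)
      = (\<integral>\<^sup>+ y. ennreal (indicator {x - b<..<x + b} y *\<^sub>R neglog y) \<partial>lborel)"
    by (rule nn_integral_cong_AE, use AE_window_prob_pos in eventually_elim)
      (use assms in \<open>auto simp: indicator_def surprisal_def neglog_def\<close>)
  also have "\<dots> = ennreal (LINT y:{x - b<..<x + b}|lborel. neglog y)"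
    unfolding set_lebesgue_integral_def
    by (intro nn_integral_eq_integral integrable_mult_indicator integrable_neglog)
      (auto simp: neglog_nonneg)
  finally have "info_dens b p x = ennreal (rpar b * integral {x - b..x + b} neglog)"
    using rpar_pos[OF b_pos] by (simp add: info_dens_eq[OF adm b_pos] set_integral_neglog ennreal_mult')
  moreover have "0 \<le> integral {x - b..x + b} neglog"
    by (intro integral_nonneg neglog_integrable_on) (auto simp: neglog_nonneg)
  ultimately show ?thesis
    using rpar_pos[OF b_pos] by (simp add: info_def)
qed

end

section \<open>Gaps of the support\<close>

text \<open>A nonempty open interval is not a null set.\<close>

lemma AE_lborel_obtain_between:
  fixes u v :: real
  assumes "AE y in lborel. P y" "u < v"
  obtains y where "u < y" "y < v" "P y"
proof -
  have not_null: "\<not> (AE y in lborel. y \<notin> {u<..<v})"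
    using assms(2) by (subst AE_iff_measurable[where N="{u<..<v}"]) auto
  have "\<exists>y\<in>{u<..<v}. P y"
  proof (rule ccontr)
    assume none: "\<not> ?thesis"
    have "AE y in lborel. y \<notin> {u<..<v}"
      using assms(1) by eventually_elim (use none in blast)
    then show False using not_null by contradiction
  qed
  then show ?thesis using that by auto
qed

text \<open>The bound is asked for in the interior only, since monotonicity on a gap is available
  strictly between its ends.\<close>

lemma integral_le_const_open:
  fixes f :: "real \<Rightarrow> real"
  assumes "f integrable_on {u..v}" "u \<le> v" "\<And>s. u < s \<Longrightarrow> s < v \<Longrightarrow> f s \<le> k"
  shows "integral {u..v} f \<le> k * (v - u)"
proof -
  have "integral {u<..<v} f \<le> integral {u<..<v} (\<lambda>_. k)"
    using assms by (intro integral_le) (auto simp: integrable_on_open_interval_real)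
  then show ?thesis
    unfolding integral_open_interval_real[symmetric] using assms(2) by (simp add: mult.commute)
qed

lemma integral_ge_const_open:
  fixes f :: "real \<Rightarrow> real"
  assumes "f integrable_on {u..v}" "u \<le> v" "\<And>s. u < s \<Longrightarrow> s < v \<Longrightarrow> k \<le> f s"
  shows "k * (v - u) \<le> integral {u..v} f"
  using integral_le_const_open[of "\<lambda>s. - f s" u v "- k"] assms
  by (simp add: integrable_neg)

text \<open>Mean value theorem on both sides of \<open>m\<close>, with a strictly increasing
  derivative. Only derivatives at interior points enter, so \<open>u = 0\<close> is covered.\<close>

lemma cost_strictly_convex:
  assumes "\<alpha> > 1" "0 \<le> u" "u < m" "m < v"
  shows "(v - u) * cost \<alpha> m < (v - m) * cost \<alpha> u + (m - u) * cost \<alpha> v"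
proof -
  have slope: "\<exists>z. s < z \<and> z < t \<and> cost \<alpha> t - cost \<alpha> s = (t - s) * (\<alpha> * z powr (\<alpha> - 1))"
    if st: "0 \<le> s" "s < t" for s t
  proof -
    have der: "(cost \<alpha> has_real_derivative \<alpha> * z powr (\<alpha> - 1)) (at z)" if "s < z" for z
      unfolding cost_def[abs_def] using that \<open>0 \<le> s\<close>
      by (auto intro!: derivative_eq_intros)
    have "continuous_on {s..t} (cost \<alpha>)"
      unfolding cost_def[abs_def] using assms that
      by (intro continuous_on_powr' continuous_intros) auto
    then obtain l z where "s < z" "z < t" "DERIV (cost \<alpha>) z :> l" "cost \<alpha> t - cost \<alpha> s = (t - s) * l"
      using MVT[of s t "cost \<alpha>"] der st(2) by (auto simp: real_differentiable_def)
    then show ?thesis using der DERIV_unique by blast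
  qed
  obtain z where z: "u < z" "z < m" "cost \<alpha> m - cost \<alpha> u = (m - u) * (\<alpha> * z powr (\<alpha> - 1))"
    using slope[of u m] assms by auto
  obtain w where w: "m < w" "w < v" "cost \<alpha> v - cost \<alpha> m = (v - m) * (\<alpha> * w powr (\<alpha> - 1))"
    using slope[of m v] assms by auto
  have "z powr (\<alpha> - 1) < w powr (\<alpha> - 1)"
    using z w assms by (intro powr_less_mono2) auto
  then have "((m - u) * (v - m) * \<alpha>) * z powr (\<alpha> - 1) < ((m - u) * (v - m) * \<alpha>) * w powr (\<alpha> - 1)"
    using assms by (intro mult_strict_left_mono) auto
  then have "(v - m) * (cost \<alpha> m - cost \<alpha> u) < (m - u) * (cost \<alpha> v - cost \<alpha> m)"
    unfolding z(3) w(3) by (simp add: algebra_simps)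
  then show ?thesis by (simp add: algebra_simps)
qed

lemma closed_support: "closed (support p)"
proof -
  have "- support p = \<Union>{U. open U \<and> emeasure p U = 0}"
    by (auto simp: support_def)
  then show ?thesis
    unfolding closed_def by (simp only:) (auto intro!: open_Union)
qed

text \<open>By the Lindelof property, countably many null open sets already cover the complement of
  the support.\<close>

lemma AE_in_support:
  assumes "sets p = sets borel"
  shows "AE x in p. x \<in> support p"
proof -
  let ?F = "{U. open U \<and> emeasure p U = 0}"
  obtain F where F: "F \<subseteq> ?F" "countable F" "\<Union>F = \<Union>?F"
    using Lindelof[of ?F] by blast
  have "(\<Union>U\<in>F. U) \<in> null_sets p"
    using F assms by (intro null_sets_UN') (auto simp: null_sets_def)
  moreover have "{x \<in> space p. x \<notin> support p} \<subseteq> (\<Union>U\<in>F. U)"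
    using F(3) by (auto simp: support_def)
  ultimately show ?thesis by (rule AE_I')
qed

section \<open>Multiplier equality on the support and concavity on gaps\<close>

context optimal_input
begin

definition neglog_primitive :: "real \<Rightarrow> real" where
  "neglog_primitive u = integral {-b..u} neglog"

lemma integral_neglog:
  assumes "-b \<le> u" "u \<le> v"
  shows "integral {u..v} neglog = neglog_primitive v - neglog_primitive u"
  using Henstock_Kurzweil_Integration.integral_combine[OF assms neglog_integrable_on]
  by (simp add: neglog_primitive_def)

lemma info_eq_primitive:
  assumes "x \<in> {0..1}"
  shows "info x = rpar b * (neglog_primitive (x + b) - neglog_primitive (x - b))"
  using assms b_pos by (simp add: info_eq_integral integral_neglog)

lemma continuous_on_info: "continuous_on {0..1} info"
proof -
  have c: "continuous_on {-b..1 + b} neglog_primitive"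
    unfolding neglog_primitive_def[abs_def]
    by (rule indefinite_integral_continuous_1[OF neglog_integrable_on])
  have c1: "continuous_on {0..1} (\<lambda>x. neglog_primitive (x + b))"
    by (rule continuous_on_compose2[OF c]) (use b_pos in \<open>auto intro!: continuous_intros\<close>)
  have c2: "continuous_on {0..1} (\<lambda>x. neglog_primitive (x - b))"
    by (rule continuous_on_compose2[OF c]) (use b_pos in \<open>auto intro!: continuous_intros\<close>)
  have "continuous_on {0..1} (\<lambda>x. rpar b * (neglog_primitive (x + b) - neglog_primitive (x - b)))"
    by (rule continuous_on_mult_left[OF continuous_on_diff[OF c1 c2]])
  then show ?thesis
    by (rule continuous_on_eq) (simp add: info_eq_primitive)
qed

text \<open>Both sides are continuous, so a strict inequality at \<open>x\<close> would persist on a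
  neighbourhood, which almost sure slackness makes null; that is impossible at a support
  point.\<close>

lemma info_eq_on_support:
  assumes "\<mu> \<ge> 0" "\<forall>x\<in>{0..1}. info x - cap \<le> \<mu> * (cost \<alpha> x - cbar)"
    and x: "x \<in> support p" "x \<in> {0..1}"
  shows "info x - cap = \<mu> * (cost \<alpha> x - cbar)"
proof (rule ccontr)
  assume ne: "\<not> ?thesis"
  let ?g = "\<lambda>x. info x - cap - \<mu> * (cost \<alpha> x - cbar)"
  have "continuous_on {0..1} (cost \<alpha>)"
    unfolding cost_def[abs_def] using alpha_pos by (intro continuous_on_powr' continuous_intros) auto
  then have cont: "continuous_on {0..1} ?g"
    by (intro continuous_intros continuous_on_info)
  have "?g x < 0" using ne assms(2) x(2) by force
  moreover have "(?g \<longlongrightarrow> ?g x) (at x within {0..1})"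
    using cont x(2) by (simp add: continuous_on_def)
  ultimately have "\<forall>\<^sub>F y in at x within {0..1}. ?g y < 0"
    by (rule order_tendstoD(2)[rotated])
  then obtain U where U: "open U" "x \<in> U" "\<And>y. y \<in> U \<Longrightarrow> y \<noteq> x \<Longrightarrow> y \<in> {0..1} \<Longrightarrow> ?g y < 0"
    unfolding eventually_at_topological by blast
  have "AE y in p. y \<notin> U"
    using AE_complementary_slackness[OF assms(1,2)] admissibleD(4)[OF adm]
  proof eventually_elim
    case (elim y)
    then show ?case using U(3)[of y] \<open>?g x < 0\<close> by (cases "y = x") auto
  qed
  then have "emeasure p U = 0"
    using U(1) by (subst (asm) AE_iff_measurable[where N=U]) (auto simp: sets_p admissibleD(3)[OF adm])
  then show False
    using x(1) U(1,2) by (auto simp: support_def)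
qed

lemma support_subset: "support p \<subseteq> {0..1}"
proof
  fix x assume x: "x \<in> support p"
  show "x \<in> {0..1}"
  proof (rule ccontr)
    assume "x \<notin> {0..1}"
    moreover have "open (- {0..1::real})" by (simp add: open_Compl)
    ultimately have "emeasure p (- {0..1}) > 0" using x by (auto simp: support_def)
    then show False
      using admissible_null[OF adm, of "- {0..1}"] by (simp add: emeasure_eq_measure)
  qed
qed

text \<open>Near an end point outside the support, the window probability would vanish on a set of
  positive measure, making the information density infinite there.\<close>

lemma end_points_in_support: "0 \<in> support p" "1 \<in> support p"
proof -
  show "0 \<in> support p"
  proof (rule ccontr)
    assume "0 \<notin> support p"
    then obtain U where U: "open U" "0 \<in> U" "emeasure p U = 0"
      by (auto simp: support_def)
    then obtain e where e: "e > 0" "ball 0 e \<subseteq> U" using openE by blast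
    obtain y where y: "-b < y" "y < -b + min e 1" "y \<in> {-b<..<1 + b} \<longrightarrow> 0 < window_prob b p y"
      using AE_lborel_obtain_between[OF AE_window_prob_pos, of "-b" "-b + min e 1"] e by auto
    have "t \<in> {..<0} \<union> U" if "t \<in> {y - b<..<y + b}" for t
      using that e(2) y(2) by (cases "t < 0") (auto simp: dist_real_def subset_iff)
    then have "{y - b<..<y + b} \<subseteq> {..<0} \<union> U" by blast
    then have "window_prob b p y \<le> measure p ({..<0} \<union> U)"
      unfolding window_prob_def using U(1) by (intro finite_measure_mono) (simp_all add: sets_p)
    also have "\<dots> \<le> measure p {..<0} + measure p U"
      using U by (intro measure_Un_le) (auto simp: sets_p)
    also have "\<dots> = 0"
      using U(3) admissible_null[OF adm, of "{..<0}"] by (simp add: measure_def disjoint_iff)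
    finally show False using y b_pos by auto
  qed
  show "1 \<in> support p"
  proof (rule ccontr)
    assume "1 \<notin> support p"
    then obtain U where U: "open U" "1 \<in> U" "emeasure p U = 0"
      by (auto simp: support_def)
    then obtain e where e: "e > 0" "ball 1 e \<subseteq> U" using openE by blast
    obtain y where y: "1 + b - min e 1 < y" "y < 1 + b" "y \<in> {-b<..<1 + b} \<longrightarrow> 0 < window_prob b p y"
      using AE_lborel_obtain_between[OF AE_window_prob_pos, of "1 + b - min e 1" "1 + b"] e by auto
    have "t \<in> {1<..} \<union> U" if "t \<in> {y - b<..<y + b}" for t
      using that e(2) y(1) by (cases "t > 1") (auto simp: dist_real_def subset_iff)
    then have "{y - b<..<y + b} \<subseteq> {1<..} \<union> U" by blast
    then have "window_prob b p y \<le> measure p ({1<..} \<union> U)"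
      unfolding window_prob_def using U(1) by (intro finite_measure_mono) (simp_all add: sets_p)
    also have "\<dots> \<le> measure p {1<..} + measure p U"
      using U by (intro measure_Un_le) (auto simp: sets_p)
    also have "\<dots> = 0"
      using U(3) admissible_null[OF adm, of "{1<..}"] by (simp add: measure_def disjoint_iff)
    finally show False using y b_pos by auto
  qed
qed

text \<open>The windows centred at \<open>s + b\<close> and \<open>t + b\<close> have left ends
  \<open>s\<close> and \<open>t\<close> in the gap, so the first lies in the second up to a null
  set; those centred at \<open>t - b\<close> and \<open>s - b\<close> likewise have their right ends
  in the gap.\<close>

lemma window_prob_mono_gap:
  assumes "measure p {u<..<v} = 0" "u < s" "s \<le> t" "t < v"
  shows "window_prob b p (s + b) \<le> window_prob b p (t + b)"
    and "window_prob b p (t - b) \<le> window_prob b p (s - b)"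
proof -
  have le: "measure p A \<le> measure p B" if "A \<subseteq> B \<union> {u<..<v}" "B \<in> sets borel" for A B
  proof -
    have "measure p A \<le> measure p (B \<union> {u<..<v})"
      using that by (intro finite_measure_mono) (auto simp: sets_p)
    also have "\<dots> \<le> measure p B + measure p {u<..<v}"
      using that by (intro measure_Un_le) (auto simp: sets_p)
    finally show ?thesis using assms(1) by simp
  qed
  show "window_prob b p (s + b) \<le> window_prob b p (t + b)"
    unfolding window_prob_def using assms by (intro le) auto
  show "window_prob b p (t - b) \<le> window_prob b p (s - b)"
    unfolding window_prob_def using assms by (intro le) auto
qed

text \<open>Positivity holds at almost every point; monotonicity along the gap carries it from a
  nearby such point to \<open>s\<close>.\<close>

lemma window_prob_pos_gap:
  assumes "measure p {u<..<v} = 0" "0 \<le> u" "u < s" "s < v" "v \<le> 1"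
  shows "0 < window_prob b p (s + b)" "0 < window_prob b p (s - b)"
proof -
  obtain y where y: "u + b < y" "y < s + b" "y \<in> {-b<..<1 + b} \<longrightarrow> 0 < window_prob b p y"
    using AE_lborel_obtain_between[OF AE_window_prob_pos, of "u + b" "s + b"] assms by auto
  then show "0 < window_prob b p (s + b)"
    using window_prob_mono_gap(1)[OF assms(1), of "y - b" s] assms b_pos by auto
  obtain y where y: "s - b < y" "y < v - b" "y \<in> {-b<..<1 + b} \<longrightarrow> 0 < window_prob b p y"
    using AE_lborel_obtain_between[OF AE_window_prob_pos, of "s - b" "v - b"] assms by auto
  then show "0 < window_prob b p (s - b)"
    using window_prob_mono_gap(2)[OF assms(1), of s "y + b"] assms b_pos by auto
qed

lemma neglog_mono_gap:
  assumes "measure p {u<..<v} = 0" "0 \<le> u" "u < s" "s \<le> t" "t < v" "v \<le> 1"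
  shows "neglog (t + b) \<le> neglog (s + b)" "neglog (s - b) \<le> neglog (t - b)"
  using window_prob_mono_gap[OF assms(1,3-5)] window_prob_pos_gap[OF assms(1,2), of s]
    window_prob_pos_gap[OF assms(1,2), of t] assms
  by (auto simp: neglog_def)

text \<open>The derivative \<open>rpar b * (neglog (s + b) - neglog (s - b))\<close> of the information density is
  nonincreasing on a gap: as the window moves right, mass only enters at the leading edge of one
  window and only leaves at the trailing edge of the other.\<close>

lemma info_concave_on_gap:
  assumes "measure p {u<..<v} = 0" "0 \<le> u" "u < m" "m < v" "v \<le> 1"
  shows "(v - m) * info u + (m - u) * info v \<le> (v - u) * info m"
proof -
  let ?A = neglog_primitive and ?r = "rpar b"
  \<comment> \<open>\<open>rpar b * k\<close> is the slope of a supporting line at \<open>m\<close>: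
    the secant slope from \<open>u\<close> is at least this and the one to \<open>v\<close> at most
    this.\<close>
  define k where "k = neglog (m + b) - neglog (m - b)"
  have r: "?r > 0" using rpar_pos[OF b_pos] .
  note mono = neglog_mono_gap[OF assms(1,2)]
  have "neglog (m + b) * (m + b - (u + b)) \<le> integral {u + b..m + b} neglog"
    using assms mono(1)[of "s - b" m for s]
    by (intro integral_ge_const_open neglog_integrable_on) auto
  moreover have "integral {u - b..m - b} neglog \<le> neglog (m - b) * (m - b - (u - b))"
    using assms mono(2)[of "s + b" m for s]
    by (intro integral_le_const_open neglog_integrable_on) auto
  ultimately have "k * (m - u) \<le> (?A (m + b) - ?A (u + b)) - (?A (m - b) - ?A (u - b))"
    using assms b_pos by (simp add: integral_neglog k_def algebra_simps)
  then have "?r * (k * (m - u)) \<le> ?r * ((?A (m + b) - ?A (u + b)) - (?A (m - b) - ?A (u - b)))"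
    using r by (intro mult_left_mono) auto
  then have 1: "?r * k * (m - u) \<le> info m - info u"
    using assms by (simp add: info_eq_primitive algebra_simps)
  have "integral {m + b..v + b} neglog \<le> neglog (m + b) * (v + b - (m + b))"
    using assms mono(1)[of m "s - b" for s]
    by (intro integral_le_const_open neglog_integrable_on) auto
  moreover have "neglog (m - b) * (v - b - (m - b)) \<le> integral {m - b..v - b} neglog"
    using assms mono(2)[of m "s + b" for s]
    by (intro integral_ge_const_open neglog_integrable_on) auto
  ultimately have "(?A (v + b) - ?A (m + b)) - (?A (v - b) - ?A (m - b)) \<le> k * (v - m)"
    using assms b_pos by (simp add: integral_neglog k_def algebra_simps)
  then have "?r * ((?A (v + b) - ?A (m + b)) - (?A (v - b) - ?A (m - b))) \<le> ?r * (k * (v - m))"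
    using r by (intro mult_left_mono) auto
  then have 2: "info v - info m \<le> ?r * k * (v - m)"
    using assms by (simp add: info_eq_primitive algebra_simps)
  have "(v - m) * (?r * k * (m - u)) \<le> (v - m) * (info m - info u)"
    using 1 assms by (intro mult_left_mono) auto
  moreover have "(m - u) * (info v - info m) \<le> (m - u) * (?r * k * (v - m))"
    using 2 assms by (intro mult_left_mono) auto
  ultimately show ?thesis by (simp add: algebra_simps)
qed

text \<open>The nearest support points on either side of \<open>x\<close> exist because the support
  is closed and contains 0 and 1.\<close>

lemma obtain_gap:
  assumes "x \<in> {0..1}" "x \<notin> support p"
  obtains u v where "u \<in> support p" "v \<in> support p" "u < x" "x < v" "measure p {u<..<v} = 0"
proof -
  define A where "A = support p \<inter> {..x}"
  define B where "B = support p \<inter> {x..}"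
  have A: "closed A" "A \<noteq> {}" "bdd_above A"
    using closed_support end_points_in_support assms by (auto simp: A_def)
  have B: "closed B" "B \<noteq> {}" "bdd_below B"
    using closed_support end_points_in_support assms by (auto simp: B_def)
  have uA: "Sup A \<in> A" by (rule closed_contains_Sup[OF A(2,3,1)])
  have vB: "Inf B \<in> B" by (rule closed_contains_Inf[OF B(2,3,1)])
  have "y \<notin> support p" if "Sup A < y" "y < Inf B" for y
  proof
    assume "y \<in> support p"
    then have "y \<in> A \<or> y \<in> B" by (auto simp: A_def B_def)
    then show False
      using that cSup_upper[of y A] cInf_lower[of y B] A(3) B(3) by auto
  qed
  then have "AE y in p. y \<notin> {Sup A<..<Inf B}"
    using AE_in_support[OF sets_p] by (auto elim!: eventually_mono)
  then have "measure p {Sup A<..<Inf B} = 0"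
    by (subst (asm) prob_eq_0[symmetric]) (auto simp: sets_p)
  moreover have "Sup A < x" "x < Inf B"
    using uA vB assms(2) by (auto simp: A_def B_def less_le)
  ultimately show ?thesis
    using that uA vB by (auto simp: A_def B_def)
qed

lemma support_full_or_info_const:
  "support p = {0..1} \<or> (\<forall>x\<in>{0..1}. info x = cap)"
proof -
  obtain \<mu> where mu: "\<mu> \<ge> 0" "\<forall>x\<in>{0..1}. info x - cap \<le> \<mu> * (cost \<alpha> x - cbar)"
    using exists_multiplier by auto
  note eq = info_eq_on_support[OF mu]
  have gap: "\<mu> = 0 \<and> info x = cap" if x: "x \<in> {0..1}" "x \<notin> support p" for x
  proof -
    obtain u v where uv: "u \<in> support p" "v \<in> support p" "u < x" "x < v" "measure p {u<..<v} = 0"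
      using obtain_gap[OF x] .
    then have uv': "0 \<le> u" "v \<le> 1" using support_subset by auto
    have iu: "info u = cap + \<mu> * (cost \<alpha> u - cbar)" using eq[OF uv(1)] support_subset uv(1) by auto
    have iv: "info v = cap + \<mu> * (cost \<alpha> v - cbar)" using eq[OF uv(2)] support_subset uv(2) by auto
    have "(v - x) * info u + (x - u) * info v \<le> (v - u) * info x"
      using uv uv' by (intro info_concave_on_gap) auto
    moreover have ix: "info x \<le> cap + \<mu> * (cost \<alpha> x - cbar)" using mu(2) x(1) by force
    then have "(v - u) * info x \<le> (v - u) * (cap + \<mu> * (cost \<alpha> x - cbar))"
      using uv by (intro mult_left_mono) auto
    \<comment> \<open>At \<open>u\<close> and \<open>v\<close> the information density meets the
      multiplier bound; at \<open>x\<close> it is above the chord by concavity and below the bound.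
      Strict convexity of the cost tolerates this only for \<open>\<mu> = 0\<close>.\<close>
    ultimately have "\<mu> * ((v - x) * cost \<alpha> u + (x - u) * cost \<alpha> v - (v - u) * cost \<alpha> x) \<le> 0"
      unfolding iu iv by (simp add: algebra_simps)
    moreover have "0 < (v - x) * cost \<alpha> u + (x - u) * cost \<alpha> v - (v - u) * cost \<alpha> x"
      using cost_strictly_convex[OF alpha_gt_1 uv'(1) uv(3,4)] by simp
    ultimately have mu0: "\<mu> = 0"
      using mu(1) by (simp add: mult_le_0_iff)
    have "(v - u) * cap \<le> (v - u) * info x"
      using \<open>(v - x) * info u + (x - u) * info v \<le> (v - u) * info x\<close>
      unfolding iu iv mu0 by (simp add: algebra_simps)
    then have "cap \<le> info x" using uv by simp
    then show ?thesis using mu0 ix by simp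
  qed
  show ?thesis
  proof (cases "{0..1} \<subseteq> support p")
    case True
    then show ?thesis using support_subset by auto
  next
    case False
    then have mu0: "\<mu> = 0" using gap by blast
    have "info x = cap" if "x \<in> {0..1}" for x
      using gap[OF that] eq[OF _ that] mu0 by (cases "x \<in> support p") auto
    then show ?thesis by blast
  qed
qed

end

section \<open>Inputs with constant information density\<close>

lemma AE_lborel_translate:
  fixes c :: real
  assumes "AE x in lborel. P x"
  shows "AE x in lborel. P (x + c)"
proof -
  have "AE x in distr lborel borel ((+) c). P x"
    unfolding lborel_distr_plus by (rule assms)
  then have "AE x in lborel. P (c + x)"
    by (rule AE_distrD[rotated]) simp
  then show ?thesis by (simp add: add.commute)
qed

context optimal_input
begin

text \<open>Here \<open>countable_support\<close> refers to the countable set of atoms, not to the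
  topological \<open>support\<close>.\<close>

lemma AE_no_atom: "AE x in lborel. measure p {x} = 0"
proof -
  have "{x. measure p {x} \<noteq> 0} \<in> null_sets lborel"
    by (rule countable_imp_null_set_lborel[OF countable_support])
  from AE_not_in[OF this] show ?thesis by eventually_elim simp
qed

text \<open>Differences of \<open>cdf\<close> measure half-open intervals, hence the correction by
  the atom at the right end.\<close>

lemma window_prob_eq_cdf: "window_prob b p y = cdf p (y + b) - cdf p (y - b) - measure p {y + b}"
proof -
  have "measure p {y - b<..y + b} = measure p ({y - b<..<y + b} \<union> {y + b})"
    using b_pos by (intro arg_cong[where f="measure p"]) auto
  also have "\<dots> = measure p {y - b<..<y + b} + measure p {y + b}"
    by (intro finite_measure_Union) (auto simp: sets_p)
  finally show ?thesis
    using cdf_diff_eq[of "y - b" "y + b"] b_pos by (simp add: window_prob_def)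
qed

text \<open>An atom at \<open>x\<close> near \<open>w\<close> sits in a half-open interval from
  \<open>x - \<bar>x - w\<bar>\<close> to \<open>x\<close>. Both ends tend to \<open>w\<close>,
  where \<open>cdf p\<close> is continuous, so its mass tends to 0.\<close>

lemma isCont_atom_mass:
  assumes "measure p {w} = 0"
  shows "isCont (\<lambda>x. measure p {x}) w"
proof -
  have cont: "isCont (cdf p) w" using assms isCont_cdf by blast
  have le: "measure p {x} \<le> cdf p x - cdf p (x - \<bar>x - w\<bar>)" for x
  proof (cases "x = w")
    case False
    then have "cdf p x - cdf p (x - \<bar>x - w\<bar>) = measure p {x - \<bar>x - w\<bar><..x}"
      by (intro cdf_diff_eq) auto
    moreover have "measure p {x} \<le> measure p {x - \<bar>x - w\<bar><..x}"
      using False by (intro finite_measure_mono) (auto simp: sets_p)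
    ultimately show ?thesis by simp
  qed (simp add: assms)
  have "((\<lambda>x. x - \<bar>x - w\<bar>) \<longlongrightarrow> w - \<bar>w - w\<bar>) (at w)"
    by (intro tendsto_intros)
  then have "((\<lambda>x. x - \<bar>x - w\<bar>) \<longlongrightarrow> w) (at w)"
    by simp
  then have "((\<lambda>x. cdf p (x - \<bar>x - w\<bar>)) \<longlongrightarrow> cdf p w) (at w)"
    by (rule isCont_tendsto_compose[OF cont])
  moreover have "(cdf p \<longlongrightarrow> cdf p w) (at w)"
    using cont by (simp add: isCont_def)
  ultimately have "((\<lambda>x. cdf p x - cdf p (x - \<bar>x - w\<bar>)) \<longlongrightarrow> cdf p w - cdf p w) (at w)"
    by (intro tendsto_diff)
  then have "((\<lambda>x. measure p {x}) \<longlongrightarrow> 0) (at w)"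
    using tendsto_sandwich[of "\<lambda>_. 0" "\<lambda>x. measure p {x}" "at w"
        "\<lambda>x. cdf p x - cdf p (x - \<bar>x - w\<bar>)" 0] le by simp
  then show ?thesis by (simp add: isCont_def assms)
qed

lemma isCont_neglog:
  assumes "measure p {y + b} = 0" "measure p {y - b} = 0" "0 < window_prob b p y"
  shows "isCont neglog y"
proof -
  have "isCont (\<lambda>z. cdf p (z + b)) y" "isCont (\<lambda>z. cdf p (z - b)) y" "isCont (\<lambda>z. measure p {z + b}) y"
    using assms isCont_cdf[of "y + b"] isCont_cdf[of "y - b"] isCont_atom_mass[of "y + b"]
      isCont_o2[of y "\<lambda>z. z + b" "cdf p"] isCont_o2[of y "\<lambda>z. z - b" "cdf p"]
      isCont_o2[of y "\<lambda>z. z + b" "\<lambda>x. measure p {x}"]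
    by simp_all
  then have "isCont (window_prob b p) y"
    unfolding window_prob_eq_cdf[abs_def] by (intro continuous_diff)
  then have "isCont (\<lambda>z. ln (window_prob b p z)) y"
    using assms(3) by (intro isCont_ln') auto
  then show ?thesis
    unfolding neglog_def[abs_def] by (rule continuous_minus)
qed

lemma neglog_primitive_has_derivative:
  assumes "y \<in> {-b<..<1 + b}" "isCont neglog y"
  shows "(neglog_primitive has_real_derivative neglog y) (at y)"
proof -
  have "(neglog_primitive has_vector_derivative neglog y) (at y within ({-b..1 + b} - {}))"
    unfolding neglog_primitive_def[abs_def]
    by (rule integral_has_vector_derivative_continuous_at)
      (use assms in \<open>auto simp: neglog_integrable_on intro: continuous_at_imp_continuous_at_within\<close>)
  moreover have "at y within ({-b..1 + b} - {}) = at y"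
    using assms(1) by (intro at_within_interior) simp
  ultimately show ?thesis
    by (simp add: has_real_derivative_iff_has_vector_derivative)
qed

lemma cdf_eq_0: "x < 0 \<Longrightarrow> cdf p x = 0"
  unfolding cdf_def2 by (rule admissible_null[OF adm]) auto

lemma cdf_eq_1:
  assumes "x \<ge> 1"
  shows "cdf p x = 1"
proof -
  have "AE y in p. y \<in> {..x}"
    using admissibleD(4)[OF adm] by eventually_elim (use assms in auto)
  then show ?thesis
    unfolding cdf_def2 by (subst prob_eq_1) (auto simp: sets_p)
qed

text \<open>Continuity from above along shrinking intervals around \<open>x\<close>, each of which
  contains an increment of size \<open>m\<close>.\<close>

lemma atom_mass_ge:
  assumes "\<And>\<epsilon>. \<epsilon> > 0 \<Longrightarrow> \<exists>u v. x - \<epsilon> < u \<and> u < x \<and> x < v \<and> v < x + \<epsilon> \<and> cdf p v - cdf p u = m"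
  shows "m \<le> measure p {x}"
proof -
  define A where "A i = {x - 1 / real (Suc i)<..x + 1 / real (Suc i)}" for i
  have "decseq A"
  proof (rule decseq_SucI)
    fix i
    have "1 / real (Suc (Suc i)) \<le> 1 / real (Suc i)" by (intro frac_le) auto
    then show "A (Suc i) \<subseteq> A i" unfolding A_def by (intro subsetI) (simp del: of_nat_Suc)
  qed
  then have "(\<lambda>i. measure p (A i)) \<longlonglongrightarrow> measure p (\<Inter>i. A i)"
    by (rule finite_Lim_measure_decseq[rotated]) (auto simp: A_def sets_p)
  moreover have "(\<Inter>i. A i) = {x}"
  proof -
    have "y = x" if y: "\<And>i. y \<in> A i" for y
    proof (rule ccontr)
      assume "y \<noteq> x"
      then obtain i where "inverse (real (Suc i)) < \<bar>y - x\<bar>"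
        using reals_Archimedean[of "\<bar>y - x\<bar>"] by auto
      then show False using y[of i] by (auto simp: A_def inverse_eq_divide)
    qed
    then show ?thesis by (auto simp: A_def)
  qed
  moreover have "m \<le> measure p (A i)" for i
  proof -
    obtain u v where uv: "x - 1 / real (Suc i) < u" "u < x" "x < v" "v < x + 1 / real (Suc i)" "cdf p v - cdf p u = m"
      using assms[of "1 / real (Suc i)"] by auto
    have "m = measure p {u<..v}" using cdf_diff_eq[of u v] uv by simp
    also have "\<dots> \<le> measure p (A i)"
      using uv by (intro finite_measure_mono) (auto simp: A_def sets_p)
    finally show ?thesis .
  qed
  ultimately show ?thesis
    by (auto intro: LIMSEQ_le_const)
qed

text \<open>Distinct atoms contribute separately to the mean cost. With the cost as a factor in the
  hypothesis, a point of cost 0 satisfies it whatever its mass.\<close>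

lemma sum_atoms_le_cost:
  assumes "finite J" "inj_on f J" "\<And>j. j \<in> J \<Longrightarrow> w j * cost \<alpha> (f j) \<le> measure p {f j} * cost \<alpha> (f j)"
  shows "(\<Sum>j\<in>J. w j * cost \<alpha> (f j)) \<le> (\<integral>x. cost \<alpha> x \<partial>p)"
proof -
  have "(\<Sum>j\<in>J. w j * cost \<alpha> (f j)) \<le> (\<Sum>j\<in>J. measure p {f j} * cost \<alpha> (f j))"
    by (intro sum_mono assms)
  also have "\<dots> = (\<Sum>z\<in>f ` J. measure p {z} * cost \<alpha> z)"
    using assms(2) by (simp add: sum.reindex)
  also have "\<dots> = (\<Sum>z\<in>f ` J. \<integral>x. cost \<alpha> z * indicator {z} x \<partial>p)"
    by (simp add: admissibleD(3)[OF adm] mult.commute)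
  also have "\<dots> = (\<integral>x. (\<Sum>z\<in>f ` J. cost \<alpha> z * indicator {z} x) \<partial>p)"
    by (intro Bochner_Integration.integral_sum[symmetric] integrable_mult_right integrable_real_indicator)
      (auto simp: sets_p emeasure_eq_measure)
  also have "\<dots> \<le> (\<integral>x. cost \<alpha> x \<partial>p)"
  proof (rule integral_mono)
    show "integrable p (\<lambda>x. \<Sum>z\<in>f ` J. cost \<alpha> z * indicator {z} x)"
      by (intro Bochner_Integration.integrable_sum integrable_mult_right integrable_real_indicator)
        (auto simp: sets_p emeasure_eq_measure)
    show "integrable p (cost \<alpha>)" by (rule integrable_cost[OF adm alpha_pos])
    fix x
    have "(\<Sum>z\<in>f ` J. cost \<alpha> z * indicator {z} x) = (\<Sum>z\<in>f ` J. if z = x then cost \<alpha> z else 0)"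
      by (intro sum.cong) (auto simp: indicator_def)
    also have "\<dots> \<le> cost \<alpha> x"
      using assms(1) by (simp add: sum.delta cost_def)
    finally show "(\<Sum>z\<in>f ` J. cost \<alpha> z * indicator {z} x) \<le> cost \<alpha> x" .
  qed
  finally show ?thesis .
qed

end

section \<open>The distribution function of a flat input\<close>

locale flat_optimal_input = optimal_input +
  assumes info_const: "\<And>x. x \<in> {0..1} \<Longrightarrow> info x = cap"
begin

text \<open>Differentiating the constant \<open>info\<close> equates the probabilities of the
  windows centred at \<open>x + b\<close> and \<open>x - b\<close>. When none of their ends
  \<open>x - 2 * b\<close>, \<open>x\<close>, \<open>x + 2 * b\<close> is an atom, these are
  increments of \<open>cdf p\<close>.\<close>

lemma AE_cdf_second_difference:
  "AE x in lborel. 0 < x \<and> x < 1 \<longrightarrow> cdf p (x + 2 * b) - cdf p x = cdf p x - cdf p (x - 2 * b)"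
proof -
  have "AE x in lborel. measure p {x + 2 * b} = 0" "AE x in lborel. measure p {x - 2 * b} = 0"
    using AE_lborel_translate[OF AE_no_atom, of "2 * b"] AE_lborel_translate[OF AE_no_atom, of "- 2 * b"]
    by simp_all
  moreover have "AE x in lborel. x + b \<in> {-b<..<1 + b} \<longrightarrow> 0 < window_prob b p (x + b)"
      "AE x in lborel. x - b \<in> {-b<..<1 + b} \<longrightarrow> 0 < window_prob b p (x - b)"
    using AE_lborel_translate[OF AE_window_prob_pos, of b] AE_lborel_translate[OF AE_window_prob_pos, of "- b"]
    by simp_all
  ultimately show ?thesis
    using AE_no_atom
  proof eventually_elim
    case (elim x)
    show ?case
    proof
      assume x: "0 < x \<and> x < 1"
      have pos: "0 < window_prob b p (x + b)" "0 < window_prob b p (x - b)"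
        using elim x b_pos by auto
      have c: "isCont neglog (x + b)" "isCont neglog (x - b)"
        using elim pos by (auto intro!: isCont_neglog simp: algebra_simps)
      have d1: "((\<lambda>x. neglog_primitive (x + b)) has_real_derivative neglog (x + b)) (at x)"
        using neglog_primitive_has_derivative[OF _ c(1)] x b_pos by (simp add: DERIV_shift)
      have d2: "((\<lambda>x. neglog_primitive (x - b)) has_real_derivative neglog (x - b)) (at x)"
        using neglog_primitive_has_derivative[OF _ c(2)] x b_pos DERIV_shift[of neglog_primitive _ x "- b"]
        by simp
      have "((\<lambda>x. rpar b * (neglog_primitive (x + b) - neglog_primitive (x - b)))
          has_real_derivative rpar b * (neglog (x + b) - neglog (x - b))) (at x)"
        by (intro DERIV_cmult DERIV_diff d1 d2)
      moreover have "((\<lambda>x. rpar b * (neglog_primitive (x + b) - neglog_primitive (x - b)))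
          has_real_derivative 0) (at x)"
        by (rule has_field_derivative_transform_within_open[OF DERIV_const[of cap], where S="{0<..<1}"])
          (use x info_const info_eq_primitive in auto)
      ultimately have "rpar b * (neglog (x + b) - neglog (x - b)) = 0"
        by (rule DERIV_unique)
      then have "ln (window_prob b p (x + b)) = ln (window_prob b p (x - b))"
        using rpar_pos[OF b_pos] by (simp add: neglog_def)
      then have "window_prob b p (x + b) = window_prob b p (x - b)"
        using pos by simp
      then show "cdf p (x + 2 * b) - cdf p x = cdf p x - cdf p (x - 2 * b)"
        using elim by (simp add: window_prob_eq_cdf algebra_simps)
    qed
  qed
qed

text \<open>Collects the countably many exceptional null sets at once, so that one good point starts
  a whole progression of step \<open>2 * b\<close>.\<close>

definition good :: "real \<Rightarrow> bool" where
  "good x \<longleftrightarrow> (\<forall>k. 0 < x + real k * (2 * b) \<and> x + real k * (2 * b) < 1 \<longrightarrow>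
     cdf p (x + real k * (2 * b) + 2 * b) - cdf p (x + real k * (2 * b))
       = cdf p (x + real k * (2 * b)) - cdf p (x + real k * (2 * b) - 2 * b))"

lemma AE_good: "AE x in lborel. good x"
  unfolding good_def AE_all_countable
  by (intro allI AE_lborel_translate[OF AE_cdf_second_difference])

lemma obtain_good:
  assumes "u < v"
  obtains x where "u < x" "x < v" "good x"
  using AE_lborel_obtain_between[OF AE_good assms] .

text \<open>Along the progression \<open>cdf p\<close> is arithmetic; it is 0 at
  \<open>x - 2 * b\<close> and 1 at index \<open>K\<close>, so it rises in \<open>K + 1\<close>
  equal steps.\<close>

lemma cdf_good:
  assumes "good x" "0 < x" "x < 2 * b" "1 \<le> x + real K * (2 * b)"
    and lt: "\<And>k. k < K \<Longrightarrow> x + real k * (2 * b) < 1" and "k \<le> K"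
  shows "cdf p (x + real k * (2 * b)) = (real k + 1) / (real K + 1)"
proof -
  have *: "cdf p (x + real k * (2 * b)) = (real k + 1) * cdf p x \<and>
      cdf p (x + real k * (2 * b)) - cdf p (x + real k * (2 * b) - 2 * b) = cdf p x" if "k \<le> K" for k
    using that
  proof (induction k)
    case 0
    then show ?case using cdf_eq_0[of "x - 2 * b"] assms(3) by simp
  next
    case (Suc k)
    have "0 < x + real k * (2 * b)" "x + real k * (2 * b) < 1"
      using lt[of k] Suc.prems assms(2) b_pos by (auto intro: add_pos_nonneg)
    then have "cdf p (x + real k * (2 * b) + 2 * b) - cdf p (x + real k * (2 * b))
       = cdf p (x + real k * (2 * b)) - cdf p (x + real k * (2 * b) - 2 * b)"
      using assms(1) by (simp add: good_def)
    moreover have "x + real (Suc k) * (2 * b) = x + real k * (2 * b) + 2 * b"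
      by (simp add: algebra_simps)
    ultimately show ?case using Suc by (simp add: algebra_simps)
  qed
  have "(real K + 1) * cdf p x = 1"
    using *[of K] cdf_eq_1[OF assms(4)] by simp
  then have "cdf p x = 1 / (real K + 1)" by (simp add: field_simps)
  then show ?thesis using *[OF \<open>k \<le> K\<close>] by simp
qed

text \<open>The remainder of 1 modulo \<open>2 * b\<close>. A progression starting in (0, 2b) has
  \<open>npar b + 1\<close> terms below 1 if it starts below the offset, and \<open>npar b\<close>
  if it starts above.\<close>

definition offset :: real where
  "offset = 1 - real (npar b) * (2 * b)"

lemma offset_bounds: "0 \<le> offset" "offset < 2 * b"
proof -
  have "0 \<le> rpar b" using rpar_pos[OF b_pos] by simp
  then have "real (npar b) \<le> rpar b" "rpar b < real (npar b) + 1"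
    unfolding npar_def by linarith+
  then show "0 \<le> offset" "offset < 2 * b"
    using b_pos by (simp_all add: offset_def rpar_def field_simps)
qed

lemma offset_eq_0_iff: "offset = 0 \<longleftrightarrow> rpar b \<in> \<nat>"
proof
  assume "offset = 0"
  then have "rpar b = real (npar b)" using b_pos by (simp add: offset_def rpar_def field_simps)
  then show "rpar b \<in> \<nat>" by (metis of_nat_in_Nats)
next
  assume "rpar b \<in> \<nat>"
  then obtain k where "rpar b = real k" by (auto elim: Nats_cases)
  then have "rpar b = real (npar b)" by (simp add: npar_def)
  then show "offset = 0" using b_pos by (simp add: offset_def rpar_def field_simps)
qed

lemma cdf_good_below_offset:
  assumes "good x" "0 < x" "x < offset" "k \<le> npar b + 1"
  shows "cdf p (x + real k * (2 * b)) = (real k + 1) / (real (npar b) + 2)"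
proof -
  have "x + real j * (2 * b) < 1" if "j < npar b + 1" for j
  proof -
    have "real j * (2 * b) \<le> real (npar b) * (2 * b)"
      using that b_pos by (intro mult_right_mono) auto
    then show ?thesis using assms(3) by (simp add: offset_def)
  qed
  moreover have "1 \<le> x + real (npar b + 1) * (2 * b)"
    using assms(2) offset_bounds(2) by (simp add: offset_def algebra_simps)
  ultimately show ?thesis
    using cdf_good[of x "npar b + 1" k] assms offset_bounds by (simp add: add.commute)
qed

lemma cdf_good_above_offset:
  assumes "good x" "offset < x" "x < 2 * b" "k \<le> npar b"
  shows "cdf p (x + real k * (2 * b)) = (real k + 1) / (real (npar b) + 1)"
proof -
  have "x + real j * (2 * b) < 1" if "j < npar b" for j
  proof -
    have "(real j + 1) * (2 * b) \<le> real (npar b) * (2 * b)"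
      using that b_pos by (intro mult_right_mono) auto
    then show ?thesis using assms(3) offset_bounds(1) by (simp add: offset_def algebra_simps)
  qed
  moreover have "1 \<le> x + real (npar b) * (2 * b)"
    using assms(2) by (simp add: offset_def)
  ultimately show ?thesis
    using cdf_good[of x "npar b" k] assms offset_bounds by simp
qed

text \<open>As the starting point crosses \<open>offset\<close>, the step of the progression changes
  from 1/(n+2) to 1/(n+1), so its k-th value jumps by k+1 times the difference.\<close>

lemma atom_at_offset:
  assumes "0 < offset" "k \<le> npar b"
  shows "(real k + 1) / ((real (npar b) + 1) * (real (npar b) + 2)) \<le> measure p {real k * (2 * b) + offset}"
proof (rule atom_mass_ge)
  fix \<epsilon> :: real assume e: "\<epsilon> > 0"
  obtain u where u: "max 0 (offset - \<epsilon>) < u" "u < offset" "good u"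
    using obtain_good[of "max 0 (offset - \<epsilon>)" offset] assms e by auto
  obtain v where v: "offset < v" "v < min (2 * b) (offset + \<epsilon>)" "good v"
    using obtain_good[of offset "min (2 * b) (offset + \<epsilon>)"] offset_bounds e by auto
  have "cdf p (v + real k * (2 * b)) - cdf p (u + real k * (2 * b))
      = (real k + 1) / (real (npar b) + 1) - (real k + 1) / (real (npar b) + 2)"
    using u v assms by (simp add: cdf_good_above_offset cdf_good_below_offset)
  also have "\<dots> = (real k + 1) / ((real (npar b) + 1) * (real (npar b) + 2))"
    by (simp add: divide_simps) (simp add: algebra_simps)
  finally show "\<exists>u v. real k * (2 * b) + offset - \<epsilon> < u \<and> u < real k * (2 * b) + offset \<and>
      real k * (2 * b) + offset < v \<and> v < real k * (2 * b) + offset + \<epsilon> \<and>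
      cdf p v - cdf p u = (real k + 1) / ((real (npar b) + 1) * (real (npar b) + 2))"
    using u v by (intro exI[of _ "u + real k * (2 * b)"] exI[of _ "v + real k * (2 * b)"]) auto
qed

text \<open>Just left of \<open>real k * (2 * b)\<close> lies term \<open>k - 1\<close> of a
  progression starting below \<open>2 * b\<close>; just right lies term \<open>k\<close> of one
  starting above 0. Their steps are 1/(n+1) and 1/(n+2).\<close>

lemma atom_at_multiple:
  assumes "0 < offset" "1 \<le> k" "k \<le> npar b"
  shows "(real (npar b) + 1 - real k) / ((real (npar b) + 1) * (real (npar b) + 2)) \<le> measure p {real k * (2 * b)}"
proof (rule atom_mass_ge)
  fix \<epsilon> :: real assume e: "\<epsilon> > 0"
  obtain u where u: "max offset (2 * b - \<epsilon>) < u" "u < 2 * b" "good u"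
    using obtain_good[of "max offset (2 * b - \<epsilon>)" "2 * b"] offset_bounds e by auto
  obtain v where v: "0 < v" "v < min offset \<epsilon>" "good v"
    using obtain_good[of 0 "min offset \<epsilon>"] assms e by auto
  have k: "real (k - 1) = real k - 1" using assms by (simp add: of_nat_diff)
  have "cdf p (v + real k * (2 * b)) - cdf p (u + real (k - 1) * (2 * b))
      = (real k + 1) / (real (npar b) + 2) - (real (k - 1) + 1) / (real (npar b) + 1)"
    using u v assms by (simp add: cdf_good_above_offset cdf_good_below_offset del: of_nat_diff)
  also have "\<dots> = (real (npar b) + 1 - real k) / ((real (npar b) + 1) * (real (npar b) + 2))"
    unfolding k by (simp add: divide_simps) (simp add: algebra_simps)
  finally show "\<exists>u v. real k * (2 * b) - \<epsilon> < u \<and> u < real k * (2 * b) \<and>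
      real k * (2 * b) < v \<and> v < real k * (2 * b) + \<epsilon> \<and>
      cdf p v - cdf p u = (real (npar b) + 1 - real k) / ((real (npar b) + 1) * (real (npar b) + 2))"
    using u v unfolding k
    by (intro exI[of _ "u + (real k - 1) * (2 * b)"] exI[of _ "v + real k * (2 * b)"]) (auto simp: algebra_simps)
qed

text \<open>With zero offset every start in (0, 2b) gives the step 1/(n+1), so passing a multiple of
  \<open>2 * b\<close> advances the index by one step.\<close>

lemma atom_at_multiple_integer:
  assumes "offset = 0" "1 \<le> k" "k \<le> npar b"
  shows "1 / (real (npar b) + 1) \<le> measure p {real k * (2 * b)}"
proof (rule atom_mass_ge)
  fix \<epsilon> :: real assume e: "\<epsilon> > 0"
  obtain u where u: "max 0 (2 * b - \<epsilon>) < u" "u < 2 * b" "good u"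
    using obtain_good[of "max 0 (2 * b - \<epsilon>)" "2 * b"] b_pos e by auto
  obtain v where v: "0 < v" "v < min (2 * b) \<epsilon>" "good v"
    using obtain_good[of 0 "min (2 * b) \<epsilon>"] b_pos e by auto
  have k: "real (k - 1) = real k - 1" using assms by (simp add: of_nat_diff)
  have "cdf p (v + real k * (2 * b)) - cdf p (u + real (k - 1) * (2 * b))
      = (real k + 1) / (real (npar b) + 1) - (real (k - 1) + 1) / (real (npar b) + 1)"
    using u v assms by (simp add: cdf_good_above_offset del: of_nat_diff)
  also have "\<dots> = 1 / (real (npar b) + 1)"
    unfolding k by (simp add: divide_simps)
  finally show "\<exists>u v. real k * (2 * b) - \<epsilon> < u \<and> u < real k * (2 * b) \<and>
      real k * (2 * b) < v \<and> v < real k * (2 * b) + \<epsilon> \<and> cdf p v - cdf p u = 1 / (real (npar b) + 1)"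
    using u v unfolding k
    by (intro exI[of _ "u + (real k - 1) * (2 * b)"] exI[of _ "v + real k * (2 * b)"]) (auto simp: algebra_simps)
qed

section \<open>Comparison with the critical cost\<close>

lemma std_point_odd:
  assumes "rpar b \<notin> \<nat>"
  shows "std_point b (2 * k + 1) = real k * (2 * b)"
  using assms b_pos by (simp add: std_point_def rpar_def)

text \<open>Even points are counted back from 1 in steps of \<open>2 * b\<close>, which is the same
  as counting forward from the offset.\<close>

lemma std_point_even:
  assumes "rpar b \<notin> \<nat>"
  shows "std_point b (2 * k + 2) = real k * (2 * b) + offset"
  using assms b_pos by (simp add: std_point_def rpar_def offset_def field_simps)

text \<open>The two families lie in different residue classes modulo \<open>2 * b\<close>; this
  makes the standard points distinct.\<close>

lemma multiple_ne_multiple_plus_offset: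
  assumes "0 < offset"
  shows "real k * (2 * b) \<noteq> real l * (2 * b) + offset"
proof (cases "k \<le> l")
  case True
  then have "real k * (2 * b) \<le> real l * (2 * b)" using b_pos by (intro mult_right_mono) auto
  then show ?thesis using assms by simp
next
  case False
  then have "(real l + 1) * (2 * b) \<le> real k * (2 * b)" using b_pos by (intro mult_right_mono) auto
  then show ?thesis using offset_bounds(2) by (simp add: algebra_simps)
qed

text \<open>The point 0 has no cost, so it suffices that every other standard point carries an atom
  of at least its standard mass.\<close>

lemma crit_cost_le_cost: "crit_cost b \<alpha> \<le> (\<integral>x. cost \<alpha> x \<partial>p)"
proof -
  let ?n = "npar b"
  have zero: "cost \<alpha> 0 = 0" by (simp add: cost_def)
  have wt: "w * cost \<alpha> x \<le> measure p {x} * cost \<alpha> x" if "w \<le> measure p {x}" for w x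
    using that by (intro mult_right_mono) (auto simp: cost_def)
  have "(\<Sum>j = 1..Nr b. std_mass b j * cost \<alpha> (std_point b j)) \<le> (\<integral>x. cost \<alpha> x \<partial>p)"
  proof (cases "rpar b \<in> \<nat>")
    case True
    then have off: "offset = 0" by (simp add: offset_eq_0_iff)
    then have n: "real ?n * (2 * b) = 1" by (simp add: offset_def)
    then have n0: "?n \<noteq> 0" by (cases "?n = 0") auto
    have pt: "std_point b j = real (j - 1) * (2 * b)" if "j \<ge> 1" for j
    proof -
      have "2 * b = 1 / real ?n" using n n0 by (simp add: field_simps)
      then show ?thesis using True that by (simp add: std_point_def of_nat_diff)
    qed
    show ?thesis
    proof (rule sum_atoms_le_cost)
      show "inj_on (std_point b) {1..Nr b}"
        using b_pos by (intro inj_onI) (auto simp: pt)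
      fix j assume j: "j \<in> {1..Nr b}"
      then have j': "j \<ge> 1" "j - 1 \<le> ?n" using True by (auto simp: Nr_def)
      show "std_mass b j * cost \<alpha> (std_point b j) \<le> measure p {std_point b j} * cost \<alpha> (std_point b j)"
      proof (cases "j = 1")
        case False
        then show ?thesis
          using atom_at_multiple_integer[OF off, of "j - 1"] j' True
          by (intro wt) (auto simp: pt std_mass_def add.commute)
      qed (simp add: pt zero)
    qed simp
  next
    case False
    then have off: "0 < offset" using offset_bounds(1) offset_eq_0_iff by (simp add: less_le)
    have form: "(\<exists>k\<le>?n. j = 2 * k + 1) \<or> (\<exists>k\<le>?n. j = 2 * k + 2)" if "j \<in> {1..Nr b}" for j
      using that False unfolding Nr_def by (simp, presburger)
    show ?thesis
    proof (rule sum_atoms_le_cost)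
      show "inj_on (std_point b) {1..Nr b}"
      proof (rule inj_onI)
        fix i j assume i: "i \<in> {1..Nr b}" and j: "j \<in> {1..Nr b}" and eq: "std_point b i = std_point b j"
        show "i = j"
          using form[OF i] form[OF j] eq multiple_ne_multiple_plus_offset[OF off] b_pos
          by (elim disjE exE conjE)
            (auto simp: std_point_odd[OF False, simplified] std_point_even[OF False, simplified] dest: sym)
      qed
      fix j assume j: "j \<in> {1..Nr b}"
      from form[OF j]
      show "std_mass b j * cost \<alpha> (std_point b j) \<le> measure p {std_point b j} * cost \<alpha> (std_point b j)"
      proof (elim disjE exE conjE)
        fix k assume k: "k \<le> ?n" "j = 2 * k + 1"
        show ?thesis
        proof (cases "k = 0")
          case True
          then show ?thesis using k std_point_odd[OF False, of 0] by (simp add: zero)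
        next
          case kpos: False
          have "std_mass b j = (2 * (real ?n + 1 - real k)) / (2 * ((real ?n + 1) * (real ?n + 2)))"
            using k False by (simp add: std_mass_def algebra_simps)
          then have "std_mass b j = (real ?n + 1 - real k) / ((real ?n + 1) * (real ?n + 2))"
            by (simp only: mult_divide_mult_cancel_left_if) simp
          then show ?thesis
            using atom_at_multiple[OF off, of k] kpos k std_point_odd[OF False, of k]
            by (intro wt) simp
        qed
      next
        fix k assume k: "k \<le> ?n" "j = 2 * k + 2"
        have "std_mass b j = (2 * (real k + 1)) / (2 * ((real ?n + 1) * (real ?n + 2)))"
          using k False by (simp add: std_mass_def algebra_simps)
        then have "std_mass b j = (real k + 1) / ((real ?n + 1) * (real ?n + 2))"
          by (simp only: mult_divide_mult_cancel_left_if) simp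
        then show ?thesis
          using atom_at_offset[OF off k(1)] k std_point_even[OF False, of k]
          by (intro wt) simp
      qed
    qed simp
  qed
  then show ?thesis by (simp add: crit_cost_def cost_def)
qed

end

theorem mainTheorem3:
  fixes b \<alpha> cbar :: real and p :: "real measure"
  assumes "b > 0"
    and "\<alpha> > 1"
    and "0 < cbar" and "cbar < crit_cost b \<alpha>"
    and "capacity_achieving b \<alpha> cbar p"
  shows "support p = {0..1}"
proof (rule ccontr)
  interpret optimal_input b \<alpha> cbar p
    using assms by unfold_locales auto
  assume "support p \<noteq> {0..1}"
  then interpret flat_optimal_input b \<alpha> cbar p
    using support_full_or_info_const by unfold_locales blast
  have "crit_cost b \<alpha> \<le> cbar"
    using crit_cost_le_cost feas by (auto simp: feasible_def)
  then show False using assms(4) by simp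
qed

end
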